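(* For all $d\in\mathbb{N}$, $$\boldsymbol{\lambda}\big(\mathbf{Trig}_{\le d}(\mathbb{T})\big)=\boldsymbol{\lambda}\big(\mathcal{P}_{\le d}(\mathbb{S}^1)\big)=\frac{1}{2\pi}\int_0^{2\pi}\bigg|\frac{\sin\big((d+\frac12)t\big)}{\sin\big(\frac t2\big)}\bigg|\,dt.$$ In particular, $$\lim_{d\to\infty}\frac{\boldsymbol{\lambda}\big(\mathcal{P}_{\le d}(\mathbb{S}^1)\big)}{\log d}=\frac{4}{\pi^2}.$$
   Context: $\mathbb{N}=\{1,2,\dots\}$. $\mathbb{S}^1$ is the Euclidean unit circle in $\mathbb{R}^2$ and $\mathbb{T}=\{z\in\mathbb{C}:|z|=1\}$. $\mathcal{P}_{\le d}(\mathbb{S}^1)$ is the space of restrictions to $\mathbb{S}^1$ of polynomials of degree at most $d$ on $\mathbb{R}^2$ with complex coefficients, with the supremum norm on $\mathbb{S}^1$. $\mathbf{Trig}_{\le d}(\mathbb{T})$ is the space of all trigonometric polynomials $P(z)=\sum_{|k|\le d}c_kz^k$, $z\in\mathbb{T}$, $c_k\in\mathbb{C}$, with the supremum norm on $\mathbb{T}$. Both are complex Banach spaces. For a subspace $X$ of a Banach space $Y$, $\boldsymbol{\lambda}(X,Y)=\inf\{\|P\|: P\in\mathcal{L}(Y,X),\ P|_X=\mathrm{id}_X\}$ (with $\inf\varnothing=\infty$). The (absolute) projection constant of $X$ is $\boldsymbol{\lambda}(X)=\sup\boldsymbol{\lambda}(I(X),Y)$, the supremum over all complex Banach spaces $Y$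 and all linear isometric embeddings $I\colon X\to Y$. *)

theory Defs
  imports "HOL-Analysis.Analysis" "HOL-Algebra.Module"
begin

section \<open>Complex Banach spaces with explicit carrier\<close>

text \<open>
  The projection constant quantifies over complex Banach spaces, so these are objects here: modules
  of HOL-Algebra over the field of complex numbers, together with a norm.  The multiplicative fields
  that such a module inherits from the ring record play no role.
\<close>

definition complex_field :: "complex ring" where
  "complex_field = \<lparr>carrier = UNIV, mult = (*), one = 1, zero = 0, add = (+)\<rparr>"

record 'b cnspace = "(complex, 'b) module" +
  vnorm :: "'b \<Rightarrow> real"

text \<open>
  The value 0 outside the carrier is only there because the locale \<^locale>\<open>Metric_space\<close> asks for
  nonnegativity and symmetry on the whole type.
\<close>

definition norm_dist :: "'b cnspace \<Rightarrow> 'b \<Rightarrow> 'b \<Rightarrow> real" where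
  "norm_dist Y x y =
     (if x \<in> carrier Y \<and> y \<in> carrier Y then vnorm Y (x \<ominus>\<^bsub>Y\<^esub> y) else 0)"

locale complex_normed_space = Module.module complex_field Y for Y :: "'b cnspace" (structure) +
  assumes vnorm_nonneg: "x \<in> carrier Y \<Longrightarrow> 0 \<le> vnorm Y x"
    and vnorm_eq_0_iff: "x \<in> carrier Y \<Longrightarrow> vnorm Y x = 0 \<longleftrightarrow> x = \<zero>"
    and vnorm_smult: "x \<in> carrier Y \<Longrightarrow> vnorm Y (a \<odot> x) = cmod a * vnorm Y x"
    and vnorm_triangle:
      "x \<in> carrier Y \<Longrightarrow> y \<in> carrier Y \<Longrightarrow> vnorm Y (x \<oplus> y) \<le> vnorm Y x + vnorm Y y"

locale complex_banach_space = complex_normed_space +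
  assumes complete: "Metric_space.mcomplete (carrier Y) (norm_dist Y)"

lemma (in complex_normed_space) Metric_space_norm_dist:
  "Metric_space (carrier Y) (norm_dist Y)"
proof -
  have uminus: "vnorm Y (\<ominus>\<^bsub>Y\<^esub> x) = vnorm Y x" if "x \<in> carrier Y" for x
  proof -
    have one: "\<one>\<^bsub>complex_field\<^esub> = 1" "carrier complex_field = UNIV"
      by (simp_all add: complex_field_def)
    have "a_inv complex_field 1 \<oplus>\<^bsub>complex_field\<^esub> 1 = \<zero>\<^bsub>complex_field\<^esub>"
      by (rule R.l_neg) (simp add: one)
    then have neg: "a_inv complex_field 1 = - 1"
      by (simp add: complex_field_def eq_neg_iff_add_eq_0)
    have "\<ominus>\<^bsub>Y\<^esub> x = (a_inv complex_field 1) \<odot>\<^bsub>Y\<^esub> x"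
      using smult_l_minus[of 1 x] smult_one[OF that] that by (simp add: one)
    then show ?thesis
      using vnorm_smult[OF that, of "- 1"] by (simp add: neg)
  qed
  have swap: "vnorm Y (x \<ominus>\<^bsub>Y\<^esub> y) = vnorm Y (y \<ominus>\<^bsub>Y\<^esub> x)" if "x \<in> carrier Y" "y \<in> carrier Y" for x y
  proof -
    have "\<ominus>\<^bsub>Y\<^esub> (x \<ominus>\<^bsub>Y\<^esub> y) = y \<ominus>\<^bsub>Y\<^esub> x"
      using that by (simp add: a_minus_def M.minus_add M.a_comm)
    then show ?thesis using uminus[of "x \<ominus>\<^bsub>Y\<^esub> y"] that by (simp add: a_minus_def)
  qed
  have split: "x \<ominus>\<^bsub>Y\<^esub> z = (x \<ominus>\<^bsub>Y\<^esub> y) \<oplus>\<^bsub>Y\<^esub> (y \<ominus>\<^bsub>Y\<^esub> z)"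
    if "x \<in> carrier Y" "y \<in> carrier Y" "z \<in> carrier Y" for x y z
    using that by (simp add: a_minus_def M.a_assoc M.r_neg1)
  have eq: "x \<ominus>\<^bsub>Y\<^esub> y = \<zero>\<^bsub>Y\<^esub> \<longleftrightarrow> x = y" if "x \<in> carrier Y" "y \<in> carrier Y" for x y
    using that by (metis M.minus_equality M.minus_minus M.r_neg a_minus_def
        M.a_inv_closed)
  show ?thesis
  proof
    show "0 \<le> norm_dist Y x y" for x y
      by (simp add: norm_dist_def vnorm_nonneg a_minus_def)
    show "norm_dist Y x y = norm_dist Y y x" for x y
      by (simp add: norm_dist_def swap)
    show "norm_dist Y x y = 0 \<longleftrightarrow> x = y" if "x \<in> carrier Y" "y \<in> carrier Y" for x y
      using that vnorm_eq_0_iff[of "x \<ominus>\<^bsub>Y\<^esub> y"] eq by (simp add: norm_dist_def)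
    show "norm_dist Y x z \<le> norm_dist Y x y + norm_dist Y y z"
      if "x \<in> carrier Y" "y \<in> carrier Y" "z \<in> carrier Y" for x y z
      using that vnorm_triangle[of "x \<ominus>\<^bsub>Y\<^esub> y" "y \<ominus>\<^bsub>Y\<^esub> z"] split[of x y z]
      by (simp add: norm_dist_def)
  qed
qed


section \<open>Operators and projection constants\<close>

definition linear_op :: "'a cnspace \<Rightarrow> 'b cnspace \<Rightarrow> ('a \<Rightarrow> 'b) \<Rightarrow> bool" where
  "linear_op X Y T \<longleftrightarrow>
     T \<in> carrier X \<rightarrow> carrier Y \<and>
     (\<forall>x\<in>carrier X. \<forall>y\<in>carrier X. T (x \<oplus>\<^bsub>X\<^esub> y) = T x \<oplus>\<^bsub>Y\<^esub> T y) \<and>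
     (\<forall>a. \<forall>x\<in>carrier X. T (a \<odot>\<^bsub>X\<^esub> x) = a \<odot>\<^bsub>Y\<^esub> T x)"

definition bounded_op :: "'a cnspace \<Rightarrow> 'b cnspace \<Rightarrow> ('a \<Rightarrow> 'b) \<Rightarrow> bool" where
  "bounded_op X Y T \<longleftrightarrow>
     linear_op X Y T \<and> (\<exists>C. \<forall>x\<in>carrier X. vnorm Y (T x) \<le> C * vnorm X x)"

definition op_norm :: "'a cnspace \<Rightarrow> 'b cnspace \<Rightarrow> ('a \<Rightarrow> 'b) \<Rightarrow> real" where
  "op_norm X Y T = (SUP x\<in>{x \<in> carrier X. vnorm X x \<le> 1}. vnorm Y (T x))"

definition isometric_embedding :: "'a cnspace \<Rightarrow> 'b cnspace \<Rightarrow> ('a \<Rightarrow> 'b) \<Rightarrow> bool" where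
  "isometric_embedding X Y I \<longleftrightarrow>
     linear_op X Y I \<and> (\<forall>x\<in>carrier X. vnorm Y (I x) = vnorm X x)"

text \<open>A subspace of \<open>Y\<close> is given by its set \<open>V\<close> of vectors; the infimum over the empty set is \<open>\<infinity>\<close>.\<close>

definition relative_projection_constant :: "'b set \<Rightarrow> 'b cnspace \<Rightarrow> ereal" where
  "relative_projection_constant V Y =
     (INF P\<in>{P. bounded_op Y (Y\<lparr>carrier := V\<rparr>) P \<and> (\<forall>x\<in>V. P x = x)}.
        ereal (op_norm Y (Y\<lparr>carrier := V\<rparr>) P))"

text \<open>
  A supremum over all complex Banach spaces cannot range over all types, so the type \<open>'b\<close> of the
  vectors of the ambient spaces is a parameter.  A Banach space on any other type may be transported
  to \<open>'b\<close> as soon as \<open>'b\<close> is large enough; a statement about all sufficiently large \<open>'b\<close> therefore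
  covers all complex Banach spaces.
\<close>

definition projection_constant :: "'b itself \<Rightarrow> 'a cnspace \<Rightarrow> ereal" where
  "projection_constant _ X =
     (SUP (Y, I)\<in>{(Y :: 'b cnspace, I). complex_banach_space Y \<and> isometric_embedding X Y I}.
        relative_projection_constant (I ` carrier X) Y)"


section \<open>The two function spaces\<close>

text \<open>
  A function on \<open>S\<close> is represented by its extensional version, which is \<open>undefined\<close> off \<open>S\<close>.
\<close>

definition sup_norm_space :: "'s set \<Rightarrow> ('s \<Rightarrow> complex) set \<Rightarrow> ('s \<Rightarrow> complex) cnspace" where
  "sup_norm_space S V =
     \<lparr>carrier = V,
      mult = (\<lambda>f g. \<lambda>s\<in>S. f s * g s),
      one = (\<lambda>s\<in>S. 1),
      zero = (\<lambda>s\<in>S. 0),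
      add = (\<lambda>f g. \<lambda>s\<in>S. f s + g s),
      smult = (\<lambda>a f. \<lambda>s\<in>S. a * f s),
      vnorm = (\<lambda>f. SUP s\<in>S. cmod (f s))\<rparr>"

definition Trig :: "nat \<Rightarrow> (complex \<Rightarrow> complex) cnspace" where
  "Trig d = sup_norm_space (sphere 0 1)
     {\<lambda>z\<in>sphere 0 1. \<Sum>k = - int d..int d. c k * z powi k | c :: int \<Rightarrow> complex. True}"

definition Poly_circle :: "nat \<Rightarrow> (real ^ 2 \<Rightarrow> complex) cnspace" where
  "Poly_circle d = sup_norm_space (sphere 0 1)
     {\<lambda>x\<in>sphere 0 1. \<Sum>(i, j)\<in>{(i, j). i + j \<le> d}.
        c i j * complex_of_real (x $ 1) ^ i * complex_of_real (x $ 2) ^ j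
      | c :: nat \<Rightarrow> nat \<Rightarrow> complex. True}"

end

theory Submission
  imports Defs "HOL-Real_Asymp.Real_Asymp"
begin

text \<open>
  All integrals over the circle are replaced by averages over the \<open>M\<close>-th roots of unity, which are
  exact on trigonometric polynomials of degree less than \<open>M\<close>.

  For the upper bound, a trigonometric polynomial \<open>f\<close> of degree at most \<open>d\<close> is recovered from its
  values at the roots of unity \<open>\<omega>\<^sub>j\<close> by discrete convolution with the Dirichlet kernel.  Given an
  isometric embedding into \<open>Y\<close>, the evaluations at the \<open>\<omega>\<^sub>j\<close> extend to \<open>Y\<close> by the Hahn--Banach theorem;
  inserting these extensions into the convolution gives a projection whose norm is at most the
  maximum of a Riemann sum of the modulus of the Dirichlet kernel, hence tends to the Lebesgue constant.

  For the lower bound, the ambient space is a copy of the trigonometric polynomials of large degree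
  \<open>N\<close>.  Averaging the conjugates of a projection under the rotations by the \<open>\<omega>\<^sub>j\<close> gives the
  partial Fourier sum without increasing the norm, and testing on an approximation of the sign of the
  Dirichlet kernel (Stone--Weierstrass) shows that its norm approaches the Lebesgue constant.

  The asymptotics come from splitting the integral at the zeros \<open>2 \<pi> k / (2 d + 1)\<close> of the
  kernel and bounding the arches by harmonic sums.
\<close>

text \<open>With finite sums in place of integrals only finitely many functionals have to be
  extended to \<open>Y\<close>, and every average is an algebraic identity. The price is that
  Riemann sums stand where the integral should be; the Lipschitz bound on the kernel makes this
  error O(1/M), uniformly in the evaluation point, which is what an estimate in the supremum norm
  requires.

  The ambient spaces must live on a type of which only an injection from the reals is known. A
  finite-dimensional test space meets this: the interpolation formula at roots of unity yields both
  its completeness and an injection into the reals. It also bounds the frequencies k - l that occur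
  in a projection by N + d, so that M > N + d roots isolate the diagonal exactly. The order of
  limits in the lower bound is forced by this: the accuracy e fixes N, then M tends to infinity, and
  e tends to 0 last.

  The constant \<open>4 / pi\<^sup>2\<close> is (1/pi) * (2/pi) * 2: the normalisation on the half
  period, the mean of |sin|, and the factor in the decay 2/t of 1/sin(t/2), whose integral from
  about 1/d on is asymptotic to 2 ln d.\<close>

section \<open>Module arithmetic over the complex numbers\<close>

lemma complex_field_simps [simp]:
  "carrier complex_field = UNIV" "x \<otimes>\<^bsub>complex_field\<^esub> y = x * y"
  "x \<oplus>\<^bsub>complex_field\<^esub> y = x + y" "\<one>\<^bsub>complex_field\<^esub> = 1" "\<zero>\<^bsub>complex_field\<^esub> = 0"
  by (simp_all add: complex_field_def)

lemma cring_complex_field: "cring complex_field"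
proof (rule cringI)
  show "abelian_group complex_field"
    by (rule abelian_groupI) (auto intro: exI[of _ "- x" for x] simp: algebra_simps)
  show "Group.comm_monoid complex_field"
    by (rule Group.comm_monoidI) auto
qed (auto simp: algebra_simps)

context complex_normed_space
begin

lemma smult_add_left: "x \<in> carrier Y \<Longrightarrow> (a + b) \<odot> x = a \<odot> x \<oplus> b \<odot> x"
  using smult_l_distr[of a b x] by simp

lemma smult_smult: "x \<in> carrier Y \<Longrightarrow> a \<odot> (b \<odot> x) = (a * b) \<odot> x"
  using smult_assoc1[of a b x] by simp

lemma smult_in: "x \<in> carrier Y \<Longrightarrow> a \<odot> x \<in> carrier Y"
  by simp

lemma smult_1: "x \<in> carrier Y \<Longrightarrow> 1 \<odot> x = x"
  using smult_one[of x] by simp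

lemma smult_0: "x \<in> carrier Y \<Longrightarrow> 0 \<odot> x = \<zero>"
  using smult_l_null[of x] by simp

lemma smult_add_right:
  "x \<in> carrier Y \<Longrightarrow> y \<in> carrier Y \<Longrightarrow> a \<odot> (x \<oplus> y) = a \<odot> x \<oplus> a \<odot> y"
  using smult_r_distr[of a x y] by simp

lemma add_neg: "x \<in> carrier Y \<Longrightarrow> x \<oplus> (- 1) \<odot> x = \<zero>"
  using smult_add_left[of x 1 "- 1"] by (simp add: smult_1 smult_0)

lemma a_inv_eq_smult: "x \<in> carrier Y \<Longrightarrow> \<ominus> x = (- 1) \<odot> x"
  using add_neg[of x] M.minus_equality[of "(- 1) \<odot> x" x] by (simp add: smult_in M.a_comm)

lemma vnorm_zero: "vnorm Y \<zero> = 0"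
  by (simp add: vnorm_eq_0_iff)

end

section \<open>The Hahn--Banach theorem\<close>

text \<open>Only nonnegative real scalars enter: the extension argument is carried out for real
  parts, and complex linearity is restored at the end of \<open>hahn_banach\<close>.\<close>

definition (in complex_normed_space) sublinear :: "('b \<Rightarrow> real) \<Rightarrow> bool" where
  "sublinear q \<longleftrightarrow> (\<forall>x\<in>carrier Y. \<forall>y\<in>carrier Y. q (x \<oplus> y) \<le> q x + q y) \<and>
     (\<forall>t\<ge>0. \<forall>x\<in>carrier Y. q (complex_of_real t \<odot> x) = t * q x)"

context complex_normed_space
begin

text \<open>For t > 0 an inequality is enough, because its instance for the scalar 1/t and the
  vector t x is the reverse inequality.\<close>

lemma sublinearI:
  assumes "\<And>x y. x \<in> carrier Y \<Longrightarrow> y \<in> carrier Y \<Longrightarrow> q (x \<oplus> y) \<le> q x + q y"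
    and le: "\<And>t x. t > 0 \<Longrightarrow> x \<in> carrier Y \<Longrightarrow> q (complex_of_real t \<odot> x) \<le> t * q x"
    and "q \<zero> = 0"
  shows "sublinear q"
proof -
  have "q (complex_of_real t \<odot> x) = t * q x" if t: "t > 0" and x: "x \<in> carrier Y" for t x
  proof (rule antisym)
    have "complex_of_real (1 / t) \<odot> (complex_of_real t \<odot> x) = x"
      using t x by (simp add: smult_smult smult_1)
    then have "q x \<le> (1 / t) * q (complex_of_real t \<odot> x)"
      using le[of "1 / t" "complex_of_real t \<odot> x"] t x by (simp add: smult_in)
    then show "t * q x \<le> q (complex_of_real t \<odot> x)"
      using t by (simp add: field_simps)
  qed (use le that in auto)
  moreover have "q (complex_of_real 0 \<odot> x) = 0 * q x" if "x \<in> carrier Y" for x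
    using that assms(3) by (simp add: smult_0)
  ultimately show ?thesis
    unfolding sublinear_def using assms(1) by (metis less_eq_real_def)
qed

lemma sublinear_add: "sublinear q \<Longrightarrow> x \<in> carrier Y \<Longrightarrow> y \<in> carrier Y \<Longrightarrow> q (x \<oplus> y) \<le> q x + q y"
  by (simp add: sublinear_def)

lemma sublinear_scale:
  "sublinear q \<Longrightarrow> t \<ge> 0 \<Longrightarrow> x \<in> carrier Y \<Longrightarrow> q (complex_of_real t \<odot> x) = t * q x"
  by (simp add: sublinear_def)

lemma sublinear_zero: "sublinear q \<Longrightarrow> q \<zero> = 0"
  using sublinear_scale[of q 0 \<zero>] by (simp add: smult_0)

lemma sublinear_neg: "sublinear q \<Longrightarrow> x \<in> carrier Y \<Longrightarrow> - q ((- 1) \<odot> x) \<le> q x"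
  using sublinear_add[of q x "(- 1) \<odot> x"] by (simp add: smult_in add_neg sublinear_zero)

text \<open>
  Linear functionals are found as minimal sublinear ones, so that no extension along subspaces is
  needed.  The candidates are made 0 off the carrier, since otherwise minimality would not be well
  posed on the whole type.
\<close>

lemma minimal_sublinear_exists:
  assumes p: "sublinear p"
  obtains q where "sublinear q" "\<And>x. x \<in> carrier Y \<Longrightarrow> q x \<le> p x"
    "\<And>q' x. sublinear q' \<Longrightarrow> (\<And>x. x \<in> carrier Y \<Longrightarrow> q' x \<le> q x) \<Longrightarrow> x \<in> carrier Y \<Longrightarrow> q' x = q x"
proof -
  define A where "A = {q. sublinear q \<and> (\<forall>x\<in>carrier Y. q x \<le> p x) \<and> (\<forall>x. x \<notin> carrier Y \<longrightarrow> q x = 0)}"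
  define cut where "cut q = (\<lambda>x. if x \<in> carrier Y then q x else 0)" for q :: "'b \<Rightarrow> real"
  have cut_sub: "sublinear (cut q)" if "sublinear q" for q
    using that by (auto simp: sublinear_def cut_def)
  \<comment> \<open>The order is reversed, so a maximal element in the sense of Zorn is a minimal
    functional, and a chain is bounded by its pointwise infimum.\<close>
  have "\<exists>m\<in>A. \<forall>a\<in>A. a \<le> m \<longrightarrow> a = m"
  proof (rule predicate_Zorn)
    show "partial_order_on A (relation_of (\<lambda>m a. a \<le> m) A)"
      by (rule partial_order_on_relation_ofI) auto
  next
    fix C assume C: "C \<in> Chains (relation_of (\<lambda>m a. a \<le> m) A)"
    then have CA: "q \<in> A" if "q \<in> C" for q
      using that by (auto simp: Chains_def relation_of_def)
    have chain: "q \<le> q' \<or> q' \<le> q" if "q \<in> C" "q' \<in> C" for q q'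
      using that C by (auto simp: Chains_def relation_of_def)
    show "\<exists>u\<in>A. \<forall>a\<in>C. u \<le> a"
    proof (cases "C = {}")
      case True
      then show ?thesis using cut_sub[OF p] by (auto simp: A_def cut_def intro!: bexI[of _ "cut p"])
    next
      case False
      define u where "u = cut (\<lambda>x. INF q\<in>C. q x)"
      \<comment> \<open>All members of the chain share a lower bound at x: 0 <= q(x) + q(-x) and
        q(-x) <= p(-x).\<close>
      have bdd: "bdd_below ((\<lambda>q. q x) ` C)" if x: "x \<in> carrier Y" for x
      proof (rule bdd_belowI2)
        fix q assume "q \<in> C"
        then have q: "q \<in> A" using CA by blast
        then show "- p ((- 1) \<odot> x) \<le> q x"
          using sublinear_neg[of q x] x smult_in[OF x, of "- 1"] order_trans[of "- p ((- 1) \<odot> x)"]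
          unfolding A_def mem_Collect_eq by (metis neg_le_iff_le)
      qed
      have ule: "u x \<le> q x" if "x \<in> carrier Y" "q \<in> C" for x q
        using that bdd[of x] by (auto simp: u_def cut_def intro!: cINF_lower)
      have uge: "c \<le> u x" if "x \<in> carrier Y" "\<And>q. q \<in> C \<Longrightarrow> c \<le> q x" for x c
        using that False by (auto simp: u_def cut_def intro!: cINF_greatest)
      have "sublinear u"
      proof (rule sublinearI)
        fix x y assume xy: "x \<in> carrier Y" "y \<in> carrier Y"
        \<comment> \<open>Subadditivity survives the infimum because two members of a chain have a
          common lower member, to which it is applied.\<close>
        have *: "u (x \<oplus> y) \<le> q1 x + q2 y" if q: "q1 \<in> C" "q2 \<in> C" for q1 q2
        proof -
          obtain q where "q \<in> C" "q \<le> q1" "q \<le> q2" using chain[OF q] q by blast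
          moreover have "u (x \<oplus> y) \<le> q (x \<oplus> y)" using ule xy \<open>q \<in> C\<close> by simp
          moreover have "q (x \<oplus> y) \<le> q x + q y"
            using CA[OF \<open>q \<in> C\<close>] xy by (simp add: A_def sublinear_add)
          ultimately show ?thesis using le_funD[of q q1 x] le_funD[of q q2 y] by linarith
        qed
        have "u (x \<oplus> y) - q1 x \<le> u y" if "q1 \<in> C" for q1
          using *[OF that] uge[OF xy(2), of "u (x \<oplus> y) - q1 x"] by (force simp: algebra_simps)
        then have "u (x \<oplus> y) - u y \<le> u x"
          using uge[OF xy(1), of "u (x \<oplus> y) - u y"] by (force simp: algebra_simps)
        then show "u (x \<oplus> y) \<le> u x + u y" by simp
      next
        fix t :: real and x assume t: "t > 0" and x: "x \<in> carrier Y"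
        have "u (complex_of_real t \<odot> x) / t \<le> q x" if "q \<in> C" for q
        proof -
          have "u (complex_of_real t \<odot> x) \<le> q (complex_of_real t \<odot> x)"
            using ule that x smult_in by simp
          also have "\<dots> = t * q x"
            using CA[OF that] t x by (auto simp: A_def sublinear_scale)
          finally show ?thesis using t by (simp add: field_simps)
        qed
        then have "u (complex_of_real t \<odot> x) / t \<le> u x" using uge x by blast
        then show "u (complex_of_real t \<odot> x) \<le> t * u x" using t by (simp add: field_simps)
      next
        have "q \<zero> = 0" if "q \<in> C" for q using CA[OF that] by (auto simp: A_def sublinear_zero)
        then have "(\<lambda>q. q \<zero>) ` C = {0}" using False by (auto simp: image_iff)
        then show "u \<zero> = 0" by (simp add: u_def cut_def)
      qed
      moreover have "u x \<le> p x" if x: "x \<in> carrier Y" for x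
      proof -
        obtain q where q: "q \<in> C" using False by blast
        show ?thesis using ule[OF x q] CA[OF q] x by (force simp: A_def)
      qed
      moreover have "u x = 0" if "x \<notin> carrier Y" for x using that by (simp add: u_def cut_def)
      moreover have "u \<le> q" if "q \<in> C" for q
      proof (rule le_funI)
        fix x show "u x \<le> q x"
          using ule[of x q] CA[OF that] that by (cases "x \<in> carrier Y") (auto simp: A_def u_def cut_def)
      qed
      ultimately show ?thesis by (auto simp: A_def)
    qed
  qed
  then obtain m where m: "m \<in> A" and min: "\<And>a. a \<in> A \<Longrightarrow> a \<le> m \<Longrightarrow> a = m" by blast
  show thesis
  proof
    fix q' x assume q': "sublinear q'" and le: "\<And>x. x \<in> carrier Y \<Longrightarrow> q' x \<le> m x" and x: "x \<in> carrier Y"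
    have "cut q' \<in> A" using cut_sub[OF q'] m le by (force simp: A_def cut_def)
    moreover have "cut q' \<le> m" using le m by (auto simp: A_def cut_def le_fun_def)
    ultimately have "cut q' = m" by (rule min)
    then show "q' x = m x" using x by (auto simp: cut_def dest: fun_cong[of _ _ x])
  qed (use m in \<open>auto simp: A_def\<close>)
qed

text \<open>The infimum over t >= 0 of q(y + t a) - t q(a) is again sublinear in y and, by t = 0,
  lies below q. Minimality makes it equal to q, and then t = 1 gives q(y) + q(a) <= q(y +
  a).\<close>

lemma minimal_sublinear_additive:
  assumes q: "sublinear q"
    and min: "\<And>q' x. sublinear q' \<Longrightarrow> (\<And>x. x \<in> carrier Y \<Longrightarrow> q' x \<le> q x) \<Longrightarrow> x \<in> carrier Y \<Longrightarrow> q' x = q x"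
    and y: "y \<in> carrier Y" and a: "a \<in> carrier Y"
  shows "q (y \<oplus> a) = q y + q a"
proof -
  define S where "S y t = q (y \<oplus> complex_of_real t \<odot> a) - t * q a" for y t
  define r where "r y = (INF t\<in>{0..}. S y t)" for y
  have cl: "complex_of_real t \<odot> a \<in> carrier Y" for t using a by (rule smult_in)
  have Sge: "- q ((- 1) \<odot> y) \<le> S y t" if y: "y \<in> carrier Y" and t: "t \<ge> 0" for y t
  proof -
    have "(y \<oplus> complex_of_real t \<odot> a) \<oplus> (- 1) \<odot> y = (y \<oplus> (- 1) \<odot> y) \<oplus> complex_of_real t \<odot> a"
      using y cl smult_in[OF y] by (simp add: M.a_ac)
    also have "\<dots> = complex_of_real t \<odot> a" using y cl by (simp add: add_neg)
    finally have "t * q a = q ((y \<oplus> complex_of_real t \<odot> a) \<oplus> (- 1) \<odot> y)"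
      using q t a by (simp add: sublinear_scale)
    also have "\<dots> \<le> q (y \<oplus> complex_of_real t \<odot> a) + q ((- 1) \<odot> y)"
      using q y cl smult_in by (intro sublinear_add) auto
    finally show ?thesis by (simp add: S_def)
  qed
  have rle: "r y \<le> S y t" if "y \<in> carrier Y" "t \<ge> 0" for y t
    unfolding r_def using that Sge[OF that(1)] by (intro cINF_lower) (auto intro!: bdd_belowI2)
  have rge: "c \<le> r y" if "\<And>t. t \<ge> 0 \<Longrightarrow> c \<le> S y t" for y c
    unfolding r_def using that by (intro cINF_greatest) auto
  have "sublinear r"
  proof (rule sublinearI)
    fix x y assume xy: "x \<in> carrier Y" "y \<in> carrier Y"
    have *: "r (x \<oplus> y) \<le> S x t + S y s" if "t \<ge> 0" "s \<ge> 0" for t s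
    proof -
      have "(x \<oplus> y) \<oplus> complex_of_real (t + s) \<odot> a
          = (x \<oplus> complex_of_real t \<odot> a) \<oplus> (y \<oplus> complex_of_real s \<odot> a)"
        using xy cl a by (simp add: smult_add_left M.a_ac)
      then have "S (x \<oplus> y) (t + s) \<le> S x t + S y s"
        using sublinear_add[OF q, of "x \<oplus> complex_of_real t \<odot> a" "y \<oplus> complex_of_real s \<odot> a"] xy cl
        by (simp add: S_def algebra_simps)
      then show ?thesis using rle[of "x \<oplus> y" "t + s"] xy that by simp
    qed
    have "r (x \<oplus> y) - S x t \<le> r y" if "t \<ge> 0" for t
      using *[OF that] rge[of "r (x \<oplus> y) - S x t"] by (force simp: algebra_simps)
    then have "r (x \<oplus> y) - r y \<le> r x"
      using rge[of "r (x \<oplus> y) - r y"] by (force simp: algebra_simps)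
    then show "r (x \<oplus> y) \<le> r x + r y" by simp
  next
    fix s :: real and x assume s: "s > 0" and x: "x \<in> carrier Y"
    have "r (complex_of_real s \<odot> x) / s \<le> S x t" if t: "t \<ge> 0" for t
    proof -
      have "complex_of_real s \<odot> x \<oplus> complex_of_real (s * t) \<odot> a
          = complex_of_real s \<odot> (x \<oplus> complex_of_real t \<odot> a)"
        using x a cl by (simp add: smult_add_right smult_smult smult_in)
      then have "S (complex_of_real s \<odot> x) (s * t) = s * S x t"
        using q s x cl by (simp add: S_def sublinear_scale algebra_simps)
      then show ?thesis using rle[of "complex_of_real s \<odot> x" "s * t"] s t x smult_in by (simp add: field_simps)
    qed
    then have "r (complex_of_real s \<odot> x) / s \<le> r x" by (rule rge)
    then show "r (complex_of_real s \<odot> x) \<le> s * r x" using s by (simp add: field_simps)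
  next
    have "S \<zero> t = 0" if "t \<ge> 0" for t
      using that q a cl by (simp add: S_def sublinear_scale)
    then have "S \<zero> ` {0..} = {0}" by (force simp: image_iff)
    then show "r \<zero> = 0" by (simp add: r_def)
  qed
  moreover have "r x \<le> q x" if "x \<in> carrier Y" for x
    using rle[OF that, of 0] that a by (simp add: S_def smult_0)
  ultimately have "r y = q y" using min y by blast
  then have "q y + q a \<le> q (y \<oplus> a)"
    using rle[OF y, of 1] a by (simp add: S_def smult_1)
  then show ?thesis using sublinear_add[OF q y a] by simp
qed

end

text \<open>
  A linear functional below the functional \<open>p\<close> of the proof extends \<open>Re f\<close>, because
  \<open>p (I x) \<le> Re (f x)\<close> for \<open>x\<close> and for \<open>- x\<close>.
\<close>

theorem hahn_banach:
  assumes "complex_normed_space X" "complex_normed_space Y"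
    and emb: "isometric_embedding X Y I"
    and f_add: "\<And>x y. x \<in> carrier X \<Longrightarrow> y \<in> carrier X \<Longrightarrow> f (x \<oplus>\<^bsub>X\<^esub> y) = f x + f y"
    and f_smult: "\<And>a x. x \<in> carrier X \<Longrightarrow> f (a \<odot>\<^bsub>X\<^esub> x) = a * f x"
    and f_le: "\<And>x. x \<in> carrier X \<Longrightarrow> cmod (f x) \<le> vnorm X x"
  obtains \<phi> where "\<And>y z. y \<in> carrier Y \<Longrightarrow> z \<in> carrier Y \<Longrightarrow> \<phi> (y \<oplus>\<^bsub>Y\<^esub> z) = \<phi> y + \<phi> z"
    and "\<And>a y. y \<in> carrier Y \<Longrightarrow> \<phi> (a \<odot>\<^bsub>Y\<^esub> y) = a * \<phi> y"
    and "\<And>y. y \<in> carrier Y \<Longrightarrow> cmod (\<phi> y) \<le> vnorm Y y"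
    and "\<And>x. x \<in> carrier X \<Longrightarrow> \<phi> (I x) = f x"
proof -
  interpret X: complex_normed_space X by fact
  interpret Y: complex_normed_space Y by fact
  have I_in: "I x \<in> carrier Y" if "x \<in> carrier X" for x
    using emb that by (auto simp: isometric_embedding_def linear_op_def)
  have I_add: "I (x \<oplus>\<^bsub>X\<^esub> y) = I x \<oplus>\<^bsub>Y\<^esub> I y" if "x \<in> carrier X" "y \<in> carrier X" for x y
    using emb that by (auto simp: isometric_embedding_def linear_op_def)
  have I_smult: "I (a \<odot>\<^bsub>X\<^esub> x) = a \<odot>\<^bsub>Y\<^esub> I x" if "x \<in> carrier X" for a x
    using emb that by (auto simp: isometric_embedding_def linear_op_def)
  have I_norm: "vnorm Y (I x) = vnorm X x" if "x \<in> carrier X" for x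
    using emb that by (auto simp: isometric_embedding_def)
  have I_zero: "I \<zero>\<^bsub>X\<^esub> = \<zero>\<^bsub>Y\<^esub>"
    using I_smult[of "\<zero>\<^bsub>X\<^esub>" 0] by (simp add: X.smult_0 Y.smult_0 I_in)
  have f_zero: "f \<zero>\<^bsub>X\<^esub> = 0" using f_smult[of "\<zero>\<^bsub>X\<^esub>" 0] by (simp add: X.smult_0)
  \<comment> \<open>For a real-linear functional, lying below \<open>p\<close> combines two demands:
    being dominated by the norm (take x = 0) and extending the real part of \<open>f\<close> along
    \<open>I\<close>.\<close>
  define S where "S y x = vnorm Y (y \<oplus>\<^bsub>Y\<^esub> I x) - Re (f x)" for y x
  define p where "p y = (INF x\<in>carrier X. S y x)" for y
  \<comment> \<open>The infimum is finite because Re(f x) <= |x| = |I x| <= |y + I x| + |y|; the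
    isometry property enters here.\<close>
  have Sge: "- vnorm Y y \<le> S y x" if y: "y \<in> carrier Y" and x: "x \<in> carrier X" for y x
  proof -
    have "(y \<oplus>\<^bsub>Y\<^esub> I x) \<oplus>\<^bsub>Y\<^esub> (- 1) \<odot>\<^bsub>Y\<^esub> y = (y \<oplus>\<^bsub>Y\<^esub> (- 1) \<odot>\<^bsub>Y\<^esub> y) \<oplus>\<^bsub>Y\<^esub> I x"
      using y x Y.smult_in[OF y] I_in by (simp add: Y.M.a_ac)
    also have "\<dots> = I x" using y I_in[OF x] by (simp add: Y.add_neg)
    finally have "vnorm X x = vnorm Y ((y \<oplus>\<^bsub>Y\<^esub> I x) \<oplus>\<^bsub>Y\<^esub> (- 1) \<odot>\<^bsub>Y\<^esub> y)"
      using x by (simp add: I_norm)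
    also have "\<dots> \<le> vnorm Y (y \<oplus>\<^bsub>Y\<^esub> I x) + vnorm Y ((- 1) \<odot>\<^bsub>Y\<^esub> y)"
      using y x I_in Y.smult_in by (intro Y.vnorm_triangle) auto
    also have "vnorm Y ((- 1) \<odot>\<^bsub>Y\<^esub> y) = vnorm Y y" using y by (simp add: Y.vnorm_smult)
    finally show ?thesis
      using f_le[OF x] complex_Re_le_cmod[of "f x"] by (simp add: S_def)
  qed
  have ple: "p y \<le> S y x" if "y \<in> carrier Y" "x \<in> carrier X" for y x
    unfolding p_def using that Sge[OF that(1)] by (intro cINF_lower) (auto intro!: bdd_belowI2)
  have pge: "c \<le> p y" if "\<And>x. x \<in> carrier X \<Longrightarrow> c \<le> S y x" for y c
    unfolding p_def using that by (intro cINF_greatest) auto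
  have sub: "Y.sublinear p"
  proof (rule Y.sublinearI)
    fix y z assume yz: "y \<in> carrier Y" "z \<in> carrier Y"
    have *: "p (y \<oplus>\<^bsub>Y\<^esub> z) \<le> S y x + S z w" if xw: "x \<in> carrier X" "w \<in> carrier X" for x w
    proof -
      have "(y \<oplus>\<^bsub>Y\<^esub> z) \<oplus>\<^bsub>Y\<^esub> I (x \<oplus>\<^bsub>X\<^esub> w) = (y \<oplus>\<^bsub>Y\<^esub> I x) \<oplus>\<^bsub>Y\<^esub> (z \<oplus>\<^bsub>Y\<^esub> I w)"
        using yz xw I_in by (simp add: I_add Y.M.a_ac)
      then have "S (y \<oplus>\<^bsub>Y\<^esub> z) (x \<oplus>\<^bsub>X\<^esub> w) \<le> S y x + S z w"
        using Y.vnorm_triangle[of "y \<oplus>\<^bsub>Y\<^esub> I x" "z \<oplus>\<^bsub>Y\<^esub> I w"] yz xw I_in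
        by (simp add: S_def f_add)
      then show ?thesis using ple[of "y \<oplus>\<^bsub>Y\<^esub> z" "x \<oplus>\<^bsub>X\<^esub> w"] yz xw by simp
    qed
    have "p (y \<oplus>\<^bsub>Y\<^esub> z) - S y x \<le> p z" if "x \<in> carrier X" for x
      using *[OF that] pge[of "p (y \<oplus>\<^bsub>Y\<^esub> z) - S y x"] by (force simp: algebra_simps)
    then have "p (y \<oplus>\<^bsub>Y\<^esub> z) - p z \<le> p y"
      using pge[of "p (y \<oplus>\<^bsub>Y\<^esub> z) - p z"] by (force simp: algebra_simps)
    then show "p (y \<oplus>\<^bsub>Y\<^esub> z) \<le> p y + p z" by simp
  next
    fix s :: real and y assume s: "s > 0" and y: "y \<in> carrier Y"
    have "p (complex_of_real s \<odot>\<^bsub>Y\<^esub> y) / s \<le> S y x" if x: "x \<in> carrier X" for x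
    proof -
      have "complex_of_real s \<odot>\<^bsub>Y\<^esub> y \<oplus>\<^bsub>Y\<^esub> I (complex_of_real s \<odot>\<^bsub>X\<^esub> x)
          = complex_of_real s \<odot>\<^bsub>Y\<^esub> (y \<oplus>\<^bsub>Y\<^esub> I x)"
        using x y I_in by (simp add: I_smult Y.smult_add_right)
      then have "S (complex_of_real s \<odot>\<^bsub>Y\<^esub> y) (complex_of_real s \<odot>\<^bsub>X\<^esub> x) = s * S y x"
        using s x y I_in by (simp add: S_def Y.vnorm_smult f_smult algebra_simps)
      then show ?thesis
        using ple[of "complex_of_real s \<odot>\<^bsub>Y\<^esub> y" "complex_of_real s \<odot>\<^bsub>X\<^esub> x"] s x y
        by (simp add: field_simps X.smult_in Y.smult_in)
    qed
    then have "p (complex_of_real s \<odot>\<^bsub>Y\<^esub> y) / s \<le> p y" by (rule pge)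
    then show "p (complex_of_real s \<odot>\<^bsub>Y\<^esub> y) \<le> s * p y" using s by (simp add: field_simps)
  next
    have "0 \<le> p \<zero>\<^bsub>Y\<^esub>" using Sge[of "\<zero>\<^bsub>Y\<^esub>"] by (intro pge) (simp add: Y.vnorm_zero)
    moreover have "p \<zero>\<^bsub>Y\<^esub> \<le> 0"
      using ple[of "\<zero>\<^bsub>Y\<^esub>" "\<zero>\<^bsub>X\<^esub>"] by (simp add: S_def I_zero f_zero Y.vnorm_zero)
    ultimately show "p \<zero>\<^bsub>Y\<^esub> = 0" by simp
  qed
  obtain q where q: "Y.sublinear q" and qp: "\<And>x. x \<in> carrier Y \<Longrightarrow> q x \<le> p x"
    and min: "\<And>q' x. Y.sublinear q' \<Longrightarrow> (\<And>x. x \<in> carrier Y \<Longrightarrow> q' x \<le> q x) \<Longrightarrow> x \<in> carrier Y \<Longrightarrow> q' x = q x"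
    using Y.minimal_sublinear_exists[OF sub] by blast
  have q_add: "q (y \<oplus>\<^bsub>Y\<^esub> z) = q y + q z" if "y \<in> carrier Y" "z \<in> carrier Y" for y z
    by (rule Y.minimal_sublinear_additive[OF q _ that]) (rule min)
  have q_neg: "q ((- 1) \<odot>\<^bsub>Y\<^esub> y) = - q y" if "y \<in> carrier Y" for y
    using q_add[of y "(- 1) \<odot>\<^bsub>Y\<^esub> y"] that by (simp add: Y.add_neg Y.smult_in Y.sublinear_zero[OF q])
  have q_scale: "q (complex_of_real t \<odot>\<^bsub>Y\<^esub> y) = t * q y" if y: "y \<in> carrier Y" for t y
  proof (cases "t \<ge> 0")
    case False
    have "complex_of_real t \<odot>\<^bsub>Y\<^esub> y = (- 1) \<odot>\<^bsub>Y\<^esub> (complex_of_real (- t) \<odot>\<^bsub>Y\<^esub> y)"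
      using y by (simp add: Y.smult_smult)
    then show ?thesis
      using False y q_neg[of "complex_of_real (- t) \<odot>\<^bsub>Y\<^esub> y"] Y.sublinear_scale[OF q, of "- t" y]
      by (simp add: Y.smult_in)
  qed (use y Y.sublinear_scale[OF q] in auto)
  have q_norm: "q y \<le> vnorm Y y" if "y \<in> carrier Y" for y
    using qp[OF that] ple[OF that, of "\<zero>\<^bsub>X\<^esub>"] that by (simp add: S_def I_zero f_zero)
  have q_le_f: "q (I x) \<le> Re (f x)" if x: "x \<in> carrier X" for x
    using qp[OF I_in[OF x]] ple[OF I_in[OF x], of "(- 1) \<odot>\<^bsub>X\<^esub> x"] x
    by (simp add: S_def I_smult f_smult Y.add_neg I_in Y.vnorm_zero X.smult_in)
  have q_f: "q (I x) = Re (f x)" if x: "x \<in> carrier X" for x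
    using q_le_f[OF x] q_le_f[of "(- 1) \<odot>\<^bsub>X\<^esub> x"] x
    by (simp add: I_smult f_smult q_neg I_in X.smult_in)
  \<comment> \<open>A complex-linear functional is recovered from its real part, since its imaginary
    part at y is minus its real part at \<i> y.\<close>
  define \<phi> where "\<phi> y = Complex (q y) (- q (\<i> \<odot>\<^bsub>Y\<^esub> y))" for y
  have phi_add: "\<phi> (y \<oplus>\<^bsub>Y\<^esub> z) = \<phi> y + \<phi> z" if "y \<in> carrier Y" "z \<in> carrier Y" for y z
    using that by (simp add: \<phi>_def q_add Y.smult_add_right Y.smult_in complex_eq_iff)
  have phi_smult: "\<phi> (a \<odot>\<^bsub>Y\<^esub> y) = a * \<phi> y" if y: "y \<in> carrier Y" for a y
  proof -
    have q_eq: "q (c \<odot>\<^bsub>Y\<^esub> y) = Re c * q y + Im c * q (\<i> \<odot>\<^bsub>Y\<^esub> y)" for c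
    proof -
      have "c \<odot>\<^bsub>Y\<^esub> y = complex_of_real (Re c) \<odot>\<^bsub>Y\<^esub> y \<oplus>\<^bsub>Y\<^esub> complex_of_real (Im c) \<odot>\<^bsub>Y\<^esub> (\<i> \<odot>\<^bsub>Y\<^esub> y)"
        using y by (simp add: Y.smult_smult flip: Y.smult_add_left) (metis complex_eq mult.commute)
      then show ?thesis using y by (simp add: q_add q_scale Y.smult_in)
    qed
    have "\<i> \<odot>\<^bsub>Y\<^esub> (a \<odot>\<^bsub>Y\<^esub> y) = (\<i> * a) \<odot>\<^bsub>Y\<^esub> y" using y by (rule Y.smult_smult)
    then show ?thesis
      using q_eq[of a] q_eq[of "\<i> * a"] by (simp add: \<phi>_def complex_eq_iff)
  qed
  show thesis
  proof
    fix y assume y: "y \<in> carrier Y"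
    \<comment> \<open>A unimodular factor turns the value at y into its modulus, so that the bound
      on the real part \<open>q\<close> bounds the modulus.\<close>
    define c where "c = (if \<phi> y = 0 then 1 else cnj (\<phi> y) / cmod (\<phi> y))"
    have c: "cmod c = 1" "c * \<phi> y = cmod (\<phi> y)"
      using complex_norm_square[of "\<phi> y"]
      by (auto simp: c_def norm_divide field_simps power2_eq_square)
    have "cmod (\<phi> y) = Re (\<phi> (c \<odot>\<^bsub>Y\<^esub> y))" using phi_smult[OF y, of c] c by simp
    also have "\<dots> = q (c \<odot>\<^bsub>Y\<^esub> y)" by (simp add: \<phi>_def)
    also have "\<dots> \<le> vnorm Y (c \<odot>\<^bsub>Y\<^esub> y)" using y by (simp add: q_norm Y.smult_in)
    also have "\<dots> = vnorm Y y" using y c by (simp add: Y.vnorm_smult)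
    finally show "cmod (\<phi> y) \<le> vnorm Y y" .
  next
    fix x assume x: "x \<in> carrier X"
    then show "\<phi> (I x) = f x"
      using q_f[OF x] q_f[of "\<i> \<odot>\<^bsub>X\<^esub> x"]
      by (simp add: \<phi>_def I_smult f_smult X.smult_in complex_eq_iff)
  qed (use phi_add phi_smult in auto)
qed

section \<open>Completeness in terms of the norm, and transport of structure\<close>

context complex_normed_space
begin

lemma minus_eq_add_smult: "x \<in> carrier Y \<Longrightarrow> y \<in> carrier Y \<Longrightarrow> x \<ominus> y = x \<oplus> (- 1) \<odot> y"
  by (simp add: a_minus_def a_inv_eq_smult)

text \<open>Differences are spelled with the scalar -1: in the concrete spaces below this multiple
  is an explicit function, whereas the additive inverse of the module is only described
  implicitly.\<close>

lemma complex_banach_spaceI: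
  assumes "\<And>\<sigma> :: nat \<Rightarrow> _. (\<And>n. \<sigma> n \<in> carrier Y) \<Longrightarrow>
      (\<And>e. e > 0 \<Longrightarrow> \<exists>N. \<forall>m\<ge>N. \<forall>n\<ge>N. vnorm Y (\<sigma> m \<oplus> (- 1) \<odot> \<sigma> n) < e) \<Longrightarrow>
      \<exists>x\<in>carrier Y. \<forall>e>0. \<exists>N. \<forall>n\<ge>N. vnorm Y (\<sigma> n \<oplus> (- 1) \<odot> x) < e"
  shows "complex_banach_space Y"
proof -
  interpret M: Metric_space "carrier Y" "norm_dist Y" by (rule Metric_space_norm_dist)
  have "\<exists>x. limitin M.mtopology \<sigma> x sequentially" if \<sigma>: "M.MCauchy \<sigma>" for \<sigma> :: "nat \<Rightarrow> 'b"
  proof -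
    have in_Y: "\<sigma> n \<in> carrier Y" for n using \<sigma> by (auto simp: M.MCauchy_def)
    have nd: "norm_dist Y x y = vnorm Y (x \<oplus> (- 1) \<odot> y)" if "x \<in> carrier Y" "y \<in> carrier Y" for x y
      using that by (simp add: norm_dist_def minus_eq_add_smult)
    have "\<exists>N. \<forall>m\<ge>N. \<forall>n\<ge>N. vnorm Y (\<sigma> m \<oplus> (- 1) \<odot> \<sigma> n) < e" if "e > 0" for e
      using \<sigma> that in_Y by (simp add: M.MCauchy_def nd)
    then obtain x where x: "x \<in> carrier Y"
      and lim: "\<And>e. e > 0 \<Longrightarrow> \<exists>N. \<forall>n\<ge>N. vnorm Y (\<sigma> n \<oplus> (- 1) \<odot> x) < e"
      using assms[of \<sigma>] in_Y by blast
    have "limitin M.mtopology \<sigma> x sequentially"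
      using x in_Y lim by (simp add: M.limitin_metric eventually_sequentially nd)
    then show ?thesis ..
  qed
  then have "M.mcomplete" by (simp add: M.mcomplete_def)
  then show ?thesis by (simp add: complex_banach_space_def complex_banach_space_axioms_def complex_normed_space_axioms)
qed

end

lemma (in complex_banach_space) Cauchy_imp_convergent:
  fixes \<sigma> :: "nat \<Rightarrow> _"
  assumes in_Y: "\<And>n. \<sigma> n \<in> carrier Y"
    and cauchy: "\<And>e. e > 0 \<Longrightarrow> \<exists>N. \<forall>m\<ge>N. \<forall>n\<ge>N. vnorm Y (\<sigma> m \<oplus> (- 1) \<odot> \<sigma> n) < e"
  shows "\<exists>x\<in>carrier Y. \<forall>e>0. \<exists>N. \<forall>n\<ge>N. vnorm Y (\<sigma> n \<oplus> (- 1) \<odot> x) < e"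
proof -
  interpret M: Metric_space "carrier Y" "norm_dist Y" by (rule Metric_space_norm_dist)
  have nd: "norm_dist Y x y = vnorm Y (x \<oplus> (- 1) \<odot> y)" if "x \<in> carrier Y" "y \<in> carrier Y" for x y
    using that by (simp add: norm_dist_def minus_eq_add_smult)
  have "M.MCauchy \<sigma>"
    using in_Y cauchy unfolding M.MCauchy_def by (simp add: nd image_subset_iff)
  then obtain x where x: "limitin M.mtopology \<sigma> x sequentially"
    using complete M.mcomplete_def by blast
  then have xY: "x \<in> carrier Y" by (rule M.limitin_mspace)
  show ?thesis
    using x xY in_Y by (auto simp: M.limitin_metric eventually_sequentially nd intro!: bexI[of _ x])
qed

text \<open>The test spaces consist of functions on the circle, but an ambient space must have its
  vectors in \<open>'b\<close>; an injection copies all operations onto its image.\<close>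

lemma complex_banach_space_transport:
  fixes Z :: "'c cnspace" and g :: "'c \<Rightarrow> 'b"
  assumes "complex_banach_space Z" and inj: "inj_on g (carrier Z)"
  obtains Y :: "'b cnspace" where "complex_banach_space Y" "isometric_embedding Z Y g"
proof -
  interpret Z: complex_banach_space Z by fact
  define h where "h = inv_into (carrier Z) g"
  define Y :: "'b cnspace" where "Y = \<lparr>carrier = g ` carrier Z, mult = undefined, one = undefined,
      zero = g \<zero>\<^bsub>Z\<^esub>, add = (\<lambda>x y. g (h x \<oplus>\<^bsub>Z\<^esub> h y)), smult = (\<lambda>a x. g (a \<odot>\<^bsub>Z\<^esub> h x)),
      vnorm = (\<lambda>x. vnorm Z (h x))\<rparr>"
  have hg [simp]: "h (g z) = z" if "z \<in> carrier Z" for z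
    using that inj by (simp add: h_def)
  have Y [simp]: "carrier Y = g ` carrier Z" "\<zero>\<^bsub>Y\<^esub> = g \<zero>\<^bsub>Z\<^esub>"
    "x \<oplus>\<^bsub>Y\<^esub> y = g (h x \<oplus>\<^bsub>Z\<^esub> h y)" "a \<odot>\<^bsub>Y\<^esub> x = g (a \<odot>\<^bsub>Z\<^esub> h x)" "vnorm Y x = vnorm Z (h x)" for x y a
    by (simp_all add: Y_def)
  have "complex_normed_space Y"
  proof (rule complex_normed_space.intro)
    show "Module.module complex_field Y"
    proof (rule moduleI)
      show "abelian_group Y"
      proof (rule abelian_groupI)
        fix x assume "x \<in> carrier Y"
        then show "\<exists>y\<in>carrier Y. y \<oplus>\<^bsub>Y\<^esub> x = \<zero>\<^bsub>Y\<^esub>"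
          by (auto intro!: bexI[of _ "\<ominus>\<^bsub>Z\<^esub> z" for z] simp: Z.M.l_neg)
      qed (auto simp: Z.M.a_ac)
    qed (auto simp: cring_complex_field Z.smult_in Z.smult_add_left Z.smult_add_right
        Z.smult_smult Z.smult_1)
    show "complex_normed_space_axioms Y"
      by unfold_locales
        (auto simp: Z.vnorm_nonneg Z.vnorm_eq_0_iff Z.vnorm_smult Z.smult_in Z.vnorm_triangle
          inj_on_eq_iff[OF inj])
  qed
  then interpret Y: complex_normed_space Y .
  have "complex_banach_space Y"
  proof (rule Y.complex_banach_spaceI)
    fix \<sigma> :: "nat \<Rightarrow> _" assume \<sigma>: "\<And>n. \<sigma> n \<in> carrier Y"
      and cauchy: "\<And>e. e > 0 \<Longrightarrow> \<exists>N. \<forall>m\<ge>N. \<forall>n\<ge>N. vnorm Y (\<sigma> m \<oplus>\<^bsub>Y\<^esub> (- 1) \<odot>\<^bsub>Y\<^esub> \<sigma> n) < e"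
    have h\<sigma>: "h (\<sigma> n) \<in> carrier Z" for n using \<sigma>[of n] by auto
    have "\<exists>x\<in>carrier Z. \<forall>e>0. \<exists>N. \<forall>n\<ge>N. vnorm Z (h (\<sigma> n) \<oplus>\<^bsub>Z\<^esub> (- 1) \<odot>\<^bsub>Z\<^esub> x) < e"
      using cauchy h\<sigma> by (intro Z.Cauchy_imp_convergent) (auto simp: Z.smult_in)
    then show "\<exists>x\<in>carrier Y. \<forall>e>0. \<exists>N. \<forall>n\<ge>N. vnorm Y (\<sigma> n \<oplus>\<^bsub>Y\<^esub> (- 1) \<odot>\<^bsub>Y\<^esub> x) < e"
      using h\<sigma> by (auto simp: Z.smult_in)
  qed
  moreover have "isometric_embedding Z Y g"
    by (auto simp: isometric_embedding_def linear_op_def)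
  ultimately show thesis by (rule that)
qed

section \<open>Spaces of functions with the supremum norm\<close>

lemma sup_norm_space_simps [simp]:
  "carrier (sup_norm_space S V) = V"
  "\<zero>\<^bsub>sup_norm_space S V\<^esub> = (\<lambda>s\<in>S. 0)"
  "f \<oplus>\<^bsub>sup_norm_space S V\<^esub> g = (\<lambda>s\<in>S. f s + g s)"
  "a \<odot>\<^bsub>sup_norm_space S V\<^esub> f = (\<lambda>s\<in>S. a * f s)"
  by (simp_all add: sup_norm_space_def)

lemma vnorm_sup_norm_space: "vnorm (sup_norm_space S V) f = (SUP s\<in>S. cmod (f s))"
  by (simp add: sup_norm_space_def)

text \<open>Extensionality makes a function that vanishes on \<open>S\<close> equal to the zero
  vector; nonemptiness and boundedness make the real supremum a genuine one.\<close>

locale function_space =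
  fixes S :: "'s set" and V :: "('s \<Rightarrow> complex) set"
  assumes nonempty: "S \<noteq> {}"
    and ext: "V \<subseteq> extensional S"
    and bdd: "f \<in> V \<Longrightarrow> bdd_above ((\<lambda>s. cmod (f s)) ` S)"
    and zero_in: "(\<lambda>s\<in>S. 0) \<in> V"
    and add_in: "f \<in> V \<Longrightarrow> g \<in> V \<Longrightarrow> (\<lambda>s\<in>S. f s + g s) \<in> V"
    and smult_in: "f \<in> V \<Longrightarrow> (\<lambda>s\<in>S. a * f s) \<in> V"
begin

lemma norm_le_vnorm: "f \<in> V \<Longrightarrow> s \<in> S \<Longrightarrow> cmod (f s) \<le> vnorm (sup_norm_space S V) f"
  unfolding vnorm_sup_norm_space by (rule cSUP_upper) (use bdd in auto)

lemma vnorm_le: "(\<And>s. s \<in> S \<Longrightarrow> cmod (f s) \<le> B) \<Longrightarrow> vnorm (sup_norm_space S V) f \<le> B"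
  unfolding vnorm_sup_norm_space by (rule cSUP_least) (use nonempty in auto)

lemma ext_eqI: "f \<in> V \<Longrightarrow> g \<in> V \<Longrightarrow> (\<And>s. s \<in> S \<Longrightarrow> f s = g s) \<Longrightarrow> f = g"
  using ext by (blast intro: extensionalityI)

lemma complex_normed_space: "complex_normed_space (sup_norm_space S V)" (is "complex_normed_space ?X")
proof (rule complex_normed_space.intro)
  show "Module.module complex_field ?X"
  proof (rule moduleI)
    show "abelian_group ?X"
    proof (rule abelian_groupI)
      fix f assume f: "f \<in> carrier ?X"
      then show "\<exists>g\<in>carrier ?X. g \<oplus>\<^bsub>?X\<^esub> f = \<zero>\<^bsub>?X\<^esub>"
        using smult_in[of f "- 1"] by (auto intro!: bexI[of _ "\<lambda>s\<in>S. - 1 * f s"])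
    next
      fix f assume f: "f \<in> carrier ?X"
      then show "\<zero>\<^bsub>?X\<^esub> \<oplus>\<^bsub>?X\<^esub> f = f"
        using ext by (auto simp: fun_eq_iff extensional_def restrict_def)
    qed (auto simp: zero_in add_in intro!: restrict_ext)
    show "\<one>\<^bsub>complex_field\<^esub> \<odot>\<^bsub>?X\<^esub> f = f" if "f \<in> carrier ?X" for f
      using ext that by (auto simp: fun_eq_iff extensional_def restrict_def)
  qed (auto simp: cring_complex_field smult_in algebra_simps intro!: restrict_ext)
  show "complex_normed_space_axioms ?X"
  proof unfold_locales
    fix f assume "f \<in> carrier ?X"
    then have f: "f \<in> V" by simp
    obtain s where s: "s \<in> S" using nonempty by blast
    show nonneg: "0 \<le> vnorm ?X f" using order_trans[OF norm_ge_zero norm_le_vnorm[OF f s]] .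
    show "vnorm ?X f = 0 \<longleftrightarrow> f = \<zero>\<^bsub>?X\<^esub>"
    proof
      assume "vnorm ?X f = 0"
      then show "f = \<zero>\<^bsub>?X\<^esub>" using norm_le_vnorm[OF f] f zero_in by (force intro!: ext_eqI)
    next
      assume "f = \<zero>\<^bsub>?X\<^esub>"
      then show "vnorm ?X f = 0" using nonempty by (simp add: vnorm_sup_norm_space)
    qed
    show "vnorm ?X (a \<odot>\<^bsub>?X\<^esub> f) = cmod a * vnorm ?X f" for a
    proof (cases "a = 0")
      case False
      have "vnorm ?X (a \<odot>\<^bsub>?X\<^esub> f) \<le> cmod a * vnorm ?X f"
        using norm_le_vnorm[OF f] by (intro vnorm_le) (simp add: norm_mult mult_left_mono)
      moreover have "vnorm ?X f \<le> vnorm ?X (a \<odot>\<^bsub>?X\<^esub> f) / cmod a"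
      proof (rule vnorm_le)
        fix s assume "s \<in> S"
        then show "cmod (f s) \<le> vnorm ?X (a \<odot>\<^bsub>?X\<^esub> f) / cmod a"
          using norm_le_vnorm[OF smult_in[OF f, of a], of s] False
          by (simp add: norm_mult field_simps)
      qed
      ultimately show ?thesis using False by (simp add: field_simps)
    qed (use nonempty in \<open>simp add: vnorm_sup_norm_space\<close>)
  next
    fix f g assume "f \<in> carrier ?X" "g \<in> carrier ?X"
    then have fg: "f \<in> V" "g \<in> V" by simp_all
    show "vnorm ?X (f \<oplus>\<^bsub>?X\<^esub> g) \<le> vnorm ?X f + vnorm ?X g"
    proof (rule vnorm_le)
      fix s assume "s \<in> S"
      then show "cmod ((f \<oplus>\<^bsub>?X\<^esub> g) s) \<le> vnorm ?X f + vnorm ?X g"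
        using norm_triangle_ineq[of "f s" "g s"] norm_le_vnorm[OF fg(1), of s]
          norm_le_vnorm[OF fg(2), of s] by simp
    qed
  qed
qed

text \<open>A Cauchy sequence converges pointwise, and letting one index tend to infinity in the
  Cauchy estimate makes the convergence uniform. Closedness under pointwise limits is demanded
  because an interpolation formula delivers exactly this.\<close>

lemma complex_banach_space:
  assumes closed: "\<And>\<sigma> g. (\<And>n. \<sigma> n \<in> V) \<Longrightarrow> g \<in> extensional S \<Longrightarrow>
    (\<And>s. s \<in> S \<Longrightarrow> (\<lambda>n. \<sigma> n s) \<longlonglongrightarrow> g s) \<Longrightarrow> g \<in> V"
  shows "complex_banach_space (sup_norm_space S V)" (is "complex_banach_space ?X")
proof -
  interpret X: complex_normed_space ?X by (rule complex_normed_space)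
  show ?thesis
  proof (rule X.complex_banach_spaceI)
    fix \<sigma> :: "nat \<Rightarrow> _" assume "\<And>n. \<sigma> n \<in> carrier ?X"
      and cauchy: "\<And>e. e > 0 \<Longrightarrow> \<exists>N. \<forall>m\<ge>N. \<forall>n\<ge>N. vnorm ?X (\<sigma> m \<oplus>\<^bsub>?X\<^esub> (- 1) \<odot>\<^bsub>?X\<^esub> \<sigma> n) < e"
    then have \<sigma>: "\<sigma> n \<in> V" for n by simp
    have diff: "cmod (f s - g s) \<le> vnorm ?X (f \<oplus>\<^bsub>?X\<^esub> (- 1) \<odot>\<^bsub>?X\<^esub> g)"
      if "f \<in> V" "g \<in> V" "s \<in> S" for f g s
      using norm_le_vnorm[OF add_in[OF that(1) smult_in[OF that(2), of "- 1"]] that(3)] that(3) by simp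
    have "Cauchy (\<lambda>n. \<sigma> n s)" if s: "s \<in> S" for s
    proof (rule metric_CauchyI)
      fix e :: real assume "e > 0"
      then obtain N where "\<forall>m\<ge>N. \<forall>n\<ge>N. vnorm ?X (\<sigma> m \<oplus>\<^bsub>?X\<^esub> (- 1) \<odot>\<^bsub>?X\<^esub> \<sigma> n) < e"
        using cauchy by blast
      then have "dist (\<sigma> m s) (\<sigma> n s) < e" if "m \<ge> N" "n \<ge> N" for m n
        unfolding dist_norm using diff[OF \<sigma> \<sigma> s, of m n] that by (meson le_less_trans)
      then show "\<exists>N. \<forall>m\<ge>N. \<forall>n\<ge>N. dist (\<sigma> m s) (\<sigma> n s) < e" by blast
    qed
    then have conv: "(\<lambda>n. \<sigma> n s) \<longlonglongrightarrow> lim (\<lambda>n. \<sigma> n s)" if "s \<in> S" for s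
      using that by (simp add: Cauchy_convergent_iff convergent_LIMSEQ_iff)
    define g where "g = (\<lambda>s\<in>S. lim (\<lambda>n. \<sigma> n s))"
    have g_lim: "(\<lambda>n. \<sigma> n s) \<longlonglongrightarrow> g s" if "s \<in> S" for s using conv[OF that] that by (simp add: g_def)
    have "g \<in> extensional S" unfolding g_def by (rule restrict_extensional)
    then have gV: "g \<in> V" using closed[OF \<sigma> _ g_lim] by blast
    have "\<exists>N. \<forall>n\<ge>N. vnorm ?X (\<sigma> n \<oplus>\<^bsub>?X\<^esub> (- 1) \<odot>\<^bsub>?X\<^esub> g) < e" if e: "e > 0" for e
    proof -
      \<comment> \<open>The limit in m leaves only a weak inequality; e/2 keeps room for the strict
        bound e.\<close>
      obtain N where N: "\<And>m n. m \<ge> N \<Longrightarrow> n \<ge> N \<Longrightarrow> vnorm ?X (\<sigma> m \<oplus>\<^bsub>?X\<^esub> (- 1) \<odot>\<^bsub>?X\<^esub> \<sigma> n) < e / 2"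
        using cauchy[of "e / 2"] e by auto
      have "vnorm ?X (\<sigma> n \<oplus>\<^bsub>?X\<^esub> (- 1) \<odot>\<^bsub>?X\<^esub> g) \<le> e / 2" if n: "n \<ge> N" for n
      proof (rule vnorm_le)
        fix s assume s: "s \<in> S"
        have "(\<lambda>m. cmod (\<sigma> n s - \<sigma> m s)) \<longlonglongrightarrow> cmod (\<sigma> n s - g s)"
          by (intro tendsto_intros g_lim s)
        moreover have "cmod (\<sigma> n s - \<sigma> m s) \<le> e / 2" if "m \<ge> N" for m
          using diff[OF \<sigma> \<sigma> s, of n m] N[OF n that] by linarith
        ultimately have "cmod (\<sigma> n s - g s) \<le> e / 2" by (intro LIMSEQ_le_const2[of _ _ "e / 2"]) auto
        then show "cmod ((\<sigma> n \<oplus>\<^bsub>?X\<^esub> (- 1) \<odot>\<^bsub>?X\<^esub> g) s) \<le> e / 2" using s by simp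
      qed
      moreover have "e / 2 < e" using e by simp
      ultimately show ?thesis by (meson le_less_trans)
    qed
    then show "\<exists>x\<in>carrier ?X. \<forall>e>0. \<exists>N. \<forall>n\<ge>N. vnorm ?X (\<sigma> n \<oplus>\<^bsub>?X\<^esub> (- 1) \<odot>\<^bsub>?X\<^esub> x) < e"
      using gV by auto
  qed
qed

lemma sum_in:
  assumes "finite A" "\<And>k. k \<in> A \<Longrightarrow> b k \<in> V"
  shows "(\<lambda>s\<in>S. \<Sum>k\<in>A. c k * b k s) \<in> V"
  using assms
proof (induction A)
  case (insert k A)
  have "(\<lambda>s\<in>S. (\<lambda>s\<in>S. c k * b k s) s + (\<lambda>s\<in>S. \<Sum>k\<in>A. c k * b k s) s) \<in> V"
    using insert by (intro add_in smult_in) auto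
  moreover have "(\<lambda>s\<in>S. (\<lambda>s\<in>S. c k * b k s) s + (\<lambda>s\<in>S. \<Sum>k\<in>A. c k * b k s) s)
      = (\<lambda>s\<in>S. \<Sum>k\<in>insert k A. c k * b k s)"
    using insert by (intro restrict_ext) auto
  ultimately show ?case by metis
qed (simp add: zero_in)

lemma linear_op_sum:
  assumes T: "linear_op (sup_norm_space S V) (sup_norm_space R W) T"
    and "finite A" "\<And>k. k \<in> A \<Longrightarrow> b k \<in> V" and r: "r \<in> R"
  shows "T (\<lambda>s\<in>S. \<Sum>k\<in>A. c k * b k s) r = (\<Sum>k\<in>A. c k * T (b k) r)"
  using assms(2,3)
proof (induction A)
  case empty
  have "\<forall>a. \<forall>f\<in>V. T (\<lambda>s\<in>S. a * f s) = (\<lambda>r\<in>R. a * T f r)"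
    using T by (simp add: linear_op_def)
  from this[rule_format, of "\<lambda>s\<in>S. 0" 0] have "T (\<lambda>s\<in>S. 0) r = 0"
    using r zero_in by (simp cong: restrict_cong)
  then show ?case by (simp del: restrict_apply)
next
  case (insert k A)
  let ?f = "\<lambda>s\<in>S. c k * b k s" and ?g = "\<lambda>s\<in>S. \<Sum>k\<in>A. c k * b k s"
  have bk: "b k \<in> V" and fV: "?f \<in> V" and gV: "?g \<in> V"
    using insert by (auto intro: smult_in sum_in)
  have "(\<lambda>s\<in>S. \<Sum>k\<in>insert k A. c k * b k s) = (\<lambda>s\<in>S. ?f s + ?g s)"
    using insert by (intro restrict_ext) auto
  moreover have "T (\<lambda>s\<in>S. ?f s + ?g s) r = T ?f r + T ?g r"
  proof -
    have "\<forall>f\<in>V. \<forall>g\<in>V. T (\<lambda>s\<in>S. f s + g s) = (\<lambda>r\<in>R. T f r + T g r)"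
      using T by (simp add: linear_op_def)
    from this[rule_format, OF fV gV] show ?thesis using r by (simp del: restrict_apply add: restrict_apply'[OF r])
  qed
  moreover have "T ?f r = c k * T (b k) r" using T bk r by (simp add: linear_op_def)
  moreover have "T ?g r = (\<Sum>k\<in>A. c k * T (b k) r)" using insert by blast
  ultimately show ?case using insert by (simp del: restrict_apply)
qed

end

section \<open>Isometric copies and cardinality\<close>

text \<open>Since \<open>h\<close> maps onto \<open>S\<close>, both suprema range over the same set
  of values.\<close>

lemma isometric_embedding_reparametrize:
  assumes "h ` S' = S" and "\<And>f. f \<in> V \<Longrightarrow> (\<lambda>s\<in>S'. f (h s)) \<in> V'"
  shows "isometric_embedding (sup_norm_space S V) (sup_norm_space S' V') (\<lambda>f. \<lambda>s\<in>S'. f (h s))"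
proof -
  have "(\<lambda>s. cmod ((\<lambda>s\<in>S'. f (h s)) s)) ` S' = (\<lambda>s. cmod (f s)) ` S" for f :: "'a \<Rightarrow> complex"
    unfolding assms(1)[symmetric] image_image by (intro image_cong) auto
  moreover have "h s \<in> S" if "s \<in> S'" for s using assms(1) that by blast
  ultimately show ?thesis
    using assms(2) by (auto simp: isometric_embedding_def linear_op_def vnorm_sup_norm_space intro!: restrict_ext)
qed

text \<open>Composition with \<open>J\<close> turns an embedding of \<open>X'\<close> into an
  embedding of \<open>X\<close> with the same range, and the relative constant depends on the range
  alone. The reverse inequality comes from the inverse isometry.\<close>

lemma projection_constant_cong_isometry:
  assumes "isometric_embedding X X' J" "J ` carrier X = carrier X'"
  shows "projection_constant TYPE('b) X' \<le> projection_constant TYPE('b) X"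
  unfolding projection_constant_def
proof (rule SUP_least)
  fix p :: "'b cnspace \<times> _"
  assume "p \<in> {(Y, I). complex_banach_space Y \<and> isometric_embedding X' Y I}"
  then obtain Y I where p: "p = (Y, I)" "complex_banach_space Y" "isometric_embedding X' Y I" by auto
  have "isometric_embedding X Y (I \<circ> J)"
    using assms(1) p(3) unfolding isometric_embedding_def linear_op_def by (auto simp: Pi_iff)
  then have *: "(Y, I \<circ> J) \<in> {(Y, I). complex_banach_space Y \<and> isometric_embedding X Y I}"
    using p by simp
  have "relative_projection_constant ((I \<circ> J) ` carrier X) Y
      \<le> (SUP (Y, I)\<in>{(Y :: 'b cnspace, I). complex_banach_space Y \<and> isometric_embedding X Y I}.
        relative_projection_constant (I ` carrier X) Y)"
    using SUP_upper[OF *, of "\<lambda>(Y, I). relative_projection_constant (I ` carrier X) Y"] by simp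
  moreover have "(I \<circ> J) ` carrier X = I ` carrier X'" using assms(2) by (simp flip: image_image add: image_comp)
  ultimately show "(case p of (Y, I) \<Rightarrow> relative_projection_constant (I ` carrier X') Y)
      \<le> (SUP (Y, I)\<in>{(Y :: 'b cnspace, I). complex_banach_space Y \<and> isometric_embedding X Y I}.
        relative_projection_constant (I ` carrier X) Y)"
    using p(1) by simp
qed

text \<open>Each coordinate is encoded by its rational lower cuts.\<close>

lemma complex_sequences_inject_reals: "\<exists>h :: (nat \<Rightarrow> complex) \<Rightarrow> real. inj h"
proof -
  define cut where "cut f = {(n, q, b). of_rat q < (if b then Re (f n) else Im (f n))}"
    for f :: "nat \<Rightarrow> complex"
  have le: "x \<le> y" if "\<And>q. of_rat q < x \<Longrightarrow> of_rat q < y" for x y :: real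
  proof (rule ccontr)
    assume "\<not> x \<le> y"
    then obtain q where "y < of_rat q" "of_rat q < x" using of_rat_dense[of y x] by auto
    then show False using that[of q] by simp
  qed
  have "inj cut"
  proof (rule injI)
    fix f g assume "cut f = cut g"
    then have "of_rat q < (if b then Re (f n) else Im (f n)) \<longleftrightarrow>
        of_rat q < (if b then Re (g n) else Im (g n))" for n q b
      by (simp add: cut_def set_eq_iff)
    then have "Re (f n) = Re (g n)" "Im (f n) = Im (g n)" for n
      by (metis (full_types) antisym le)+
    then show "f = g" by (simp add: fun_eq_iff complex_eq_iff)
  qed
  \<comment> \<open>The triples of an index, a rational and a Boolean form a countable type, so the
    cuts become sets of natural numbers.\<close>
  then have "inj (\<lambda>f. to_nat ` cut f)"
    by (auto simp: inj_def inj_image_eq_iff)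
  moreover obtain g :: "nat set \<Rightarrow> real" where "inj g"
    using nat_sets_eqpoll_reals by (auto simp: eqpoll_def bij_betw_def)
  ultimately have "inj (g \<circ> (\<lambda>f. to_nat ` cut f))" by (intro inj_compose)
  then show ?thesis by blast
qed

section \<open>Trigonometric polynomials and discrete Fourier analysis\<close>

text \<open>The expansion is required on the circle only, so sums and products can be formed for
  unrestricted functions; the restriction is applied once, in \<open>carrier_Trig\<close>.\<close>

definition trig_poly :: "nat \<Rightarrow> (complex \<Rightarrow> complex) \<Rightarrow> bool" where
  "trig_poly d h \<longleftrightarrow> (\<exists>c. \<forall>z. cmod z = 1 \<longrightarrow> h z = (\<Sum>k = - int d..int d. c k * z powi k))"

lemma carrier_Trig: "carrier (Trig d) = {\<lambda>z\<in>sphere 0 1. h z | h. trig_poly d h}"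
proof (rule Set.equalityI; rule subsetI)
  fix f assume "f \<in> carrier (Trig d)"
  then show "f \<in> {\<lambda>z\<in>sphere 0 1. h z | h. trig_poly d h}"
    unfolding Trig_def sup_norm_space_simps trig_poly_def by blast
next
  fix f assume "f \<in> {\<lambda>z\<in>sphere 0 1. h z | h. trig_poly d h}"
  then obtain h c where f: "f = (\<lambda>z\<in>sphere 0 1. h z)"
    and "\<forall>z. cmod z = 1 \<longrightarrow> h z = (\<Sum>k = - int d..int d. c k * z powi k)"
    unfolding trig_poly_def by blast
  then have "f = (\<lambda>z\<in>sphere 0 1. \<Sum>k = - int d..int d. c k * z powi k)"
    by (auto intro!: restrict_ext)
  then show "f \<in> carrier (Trig d)"
    unfolding Trig_def sup_norm_space_simps by blast
qed

lemma trig_poly_powi: "\<bar>k\<bar> \<le> int d \<Longrightarrow> trig_poly d (\<lambda>z. z powi k)"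
  unfolding trig_poly_def
  by (rule exI[of _ "\<lambda>j. if j = k then 1 else 0"])
    (simp add: if_distrib[of "\<lambda>x. x * _"] abs_le_iff minus_le_iff cong: if_cong)

lemma trig_poly_cmult: "trig_poly d f \<Longrightarrow> trig_poly d (\<lambda>z. a * f z)"
  unfolding trig_poly_def
proof (erule exE)
  fix c assume "\<forall>z. cmod z = 1 \<longrightarrow> f z = (\<Sum>k = - int d..int d. c k * z powi k)"
  then show "\<exists>c. \<forall>z. cmod z = 1 \<longrightarrow> a * f z = (\<Sum>k = - int d..int d. c k * z powi k)"
    by (intro exI[of _ "\<lambda>k. a * c k"]) (simp add: sum_distrib_left mult.assoc)
qed

lemma trig_poly_add:
  assumes "trig_poly d f" "trig_poly d g"
  shows "trig_poly d (\<lambda>z. f z + g z)"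
proof -
  obtain b c where "\<forall>z. cmod z = 1 \<longrightarrow> f z = (\<Sum>k = - int d..int d. b k * z powi k)"
    "\<forall>z. cmod z = 1 \<longrightarrow> g z = (\<Sum>k = - int d..int d. c k * z powi k)"
    using assms unfolding trig_poly_def by blast
  then show ?thesis
    unfolding trig_poly_def
    by (intro exI[of _ "\<lambda>k. b k + c k"]) (simp add: sum.distrib distrib_right)
qed

lemma trig_poly_zero: "trig_poly d (\<lambda>z. 0)"
  unfolding trig_poly_def by (rule exI[of _ "\<lambda>k. 0"]) simp

lemma trig_poly_sum: "(\<And>k. k \<in> A \<Longrightarrow> trig_poly d (f k)) \<Longrightarrow> trig_poly d (\<lambda>z. \<Sum>k\<in>A. f k z)"
  by (induction A rule: infinite_finite_induct) (auto intro: trig_poly_zero trig_poly_add)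

lemma trig_poly_cong: "trig_poly d f \<Longrightarrow> (\<And>z. cmod z = 1 \<Longrightarrow> f z = g z) \<Longrightarrow> trig_poly d g"
  unfolding trig_poly_def by simp

lemma trig_poly_mono:
  assumes "trig_poly d f" "d \<le> n"
  shows "trig_poly n f"
proof -
  obtain c where "\<forall>z. cmod z = 1 \<longrightarrow> f z = (\<Sum>k = - int d..int d. c k * z powi k)"
    using assms unfolding trig_poly_def by blast
  moreover have "trig_poly n (\<lambda>z. \<Sum>k = - int d..int d. c k * z powi k)"
    using assms(2) by (intro trig_poly_sum trig_poly_cmult trig_poly_powi) auto
  ultimately show ?thesis by (auto intro: trig_poly_cong)
qed

lemma trig_poly_mult:
  assumes "trig_poly d f" "trig_poly n g"
  shows "trig_poly (d + n) (\<lambda>z. f z * g z)"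
proof -
  obtain b c where fg: "\<forall>z. cmod z = 1 \<longrightarrow> f z = (\<Sum>k = - int d..int d. b k * z powi k)"
    "\<forall>z. cmod z = 1 \<longrightarrow> g z = (\<Sum>l = - int n..int n. c l * z powi l)"
    using assms unfolding trig_poly_def by blast
  have "trig_poly (d + n) (\<lambda>z. \<Sum>k = - int d..int d. \<Sum>l = - int n..int n. b k * c l * z powi (k + l))"
    by (intro trig_poly_sum trig_poly_cmult trig_poly_powi) auto
  then show ?thesis
  proof (rule trig_poly_cong)
    fix z :: complex assume z: "cmod z = 1"
    then have "z \<noteq> 0" by auto
    then show "(\<Sum>k = - int d..int d. \<Sum>l = - int n..int n. b k * c l * z powi (k + l)) = f z * g z"
      using fg z by (simp add: sum_product power_int_add mult_ac)
  qed
qed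

lemma function_space_Trig:
  "function_space (sphere 0 1) {\<lambda>z\<in>sphere 0 1. h z | h. trig_poly d h}"
proof
  show "sphere (0::complex) 1 \<noteq> {}" by (auto intro: exI[of _ 1])
  show "{\<lambda>z\<in>sphere 0 1. h z | h. trig_poly d h} \<subseteq> extensional (sphere 0 1)" by auto
next
  fix f assume "f \<in> {\<lambda>z\<in>sphere 0 1. h z | h. trig_poly d h}"
  then obtain c where f: "\<And>z. cmod z = 1 \<Longrightarrow> f z = (\<Sum>k = - int d..int d. c k * z powi k)"
    unfolding trig_poly_def by auto
  show "bdd_above ((\<lambda>z. cmod (f z)) ` sphere 0 1)"
  proof (rule bdd_aboveI2)
    fix z :: complex assume "z \<in> sphere 0 1"
    then show "cmod (f z) \<le> (\<Sum>k = - int d..int d. cmod (c k))"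
      using norm_sum[of "\<lambda>k. c k * z powi k" "{- int d..int d}"] f[of z]
      by (simp add: norm_mult norm_power_int)
  qed
next
  show "(\<lambda>z\<in>sphere 0 1. 0) \<in> {\<lambda>z\<in>sphere 0 1. h z | h. trig_poly d h}"
    using trig_poly_zero by blast
next
  fix f g assume "f \<in> {\<lambda>z\<in>sphere 0 1. h z | h. trig_poly d h}" "g \<in> {\<lambda>z\<in>sphere 0 1. h z | h. trig_poly d h}"
  then obtain h k where "f = (\<lambda>z\<in>sphere 0 1. h z)" "trig_poly d h" "g = (\<lambda>z\<in>sphere 0 1. k z)" "trig_poly d k"
    by auto
  then show "(\<lambda>z\<in>sphere 0 1. f z + g z) \<in> {\<lambda>z\<in>sphere 0 1. h z | h. trig_poly d h}"
    by (auto intro!: exI[of _ "\<lambda>z. h z + k z"] trig_poly_add restrict_ext)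
next
  fix f a assume "f \<in> {\<lambda>z\<in>sphere 0 1. h z | h. trig_poly d h}"
  then obtain h where "f = (\<lambda>z\<in>sphere 0 1. h z)" "trig_poly d h"
    by auto
  then show "(\<lambda>z\<in>sphere 0 1. a * f z) \<in> {\<lambda>z\<in>sphere 0 1. h z | h. trig_poly d h}"
    by (auto intro!: exI[of _ "\<lambda>z. a * h z"] trig_poly_cmult restrict_ext)
qed

lemma Trig_eq: "Trig d = sup_norm_space (sphere 0 1) {\<lambda>z\<in>sphere 0 1. h z | h. trig_poly d h}"
  using carrier_Trig[of d] by (simp add: Trig_def)

lemma cnj_eq_inverse: "cmod z = 1 \<Longrightarrow> cnj z = inverse z"
  using complex_norm_square[of z] by (metis inverse_unique of_real_1 one_power2)

section \<open>Roots of unity, the Dirichlet kernel and interpolation\<close>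

definition unity_root :: "nat \<Rightarrow> nat \<Rightarrow> complex" where
  "unity_root M j = cis (2 * pi * real j / real M)"

lemma norm_unity_root [simp]: "cmod (unity_root M j) = 1"
  by (simp add: unity_root_def)

lemma unity_root_nonzero [simp]: "unity_root M j \<noteq> 0"
  by (metis norm_unity_root norm_zero zero_neq_one)

text \<open>Discrete orthogonality: the j-th summand is the j-th power of one M-th root of unity q,
  so the geometric sum vanishes unless q = 1, that is, unless M divides k.\<close>

lemma sum_unity_root_powi:
  assumes "M > 0"
  shows "(\<Sum>j<M. unity_root M j powi k) = (if int M dvd k then of_nat M else 0)"
proof -
  define q where "q = cis (2 * pi * of_int k / real M)"
  have pow: "unity_root M j powi k = q ^ j" for j
    unfolding unity_root_def q_def cis_power_int Complex.DeMoivre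
    by (rule arg_cong[of _ _ cis]) (simp add: field_simps)
  have "q ^ M = cis (2 * pi * of_int k)"
    unfolding q_def Complex.DeMoivre using assms by simp
  then have "q ^ M = 1" by simp
  show ?thesis
  proof (cases "q = 1")
    case True
    then have "cos (2 * pi * of_int k / real M) = 1" by (simp add: q_def complex_eq_iff)
    then obtain n :: int where "2 * pi * of_int k / real M = of_int n * 2 * pi"
      by (auto simp: cos_one_2pi_int)
    then have "of_int k = (of_int (n * int M) :: real)" using assms by (simp add: field_simps)
    then have "int M dvd k" by (simp only: of_int_eq_iff) simp
    then show ?thesis using True by (simp add: pow)
  next
    case False
    have "\<not> int M dvd k"
    proof
      assume "int M dvd k"
      then obtain n where "k = int M * n" ..
      then have "2 * pi * of_int k / real M = 2 * pi * real_of_int n" using assms by simp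
      then have "q = 1" unfolding q_def by (metis cis_multiple_2pi Ints_of_int)
      then show False using False by simp
    qed
    then show ?thesis using False \<open>q ^ M = 1\<close> by (simp add: pow sum_gp_strict)
  qed
qed

definition dirichlet :: "nat \<Rightarrow> complex \<Rightarrow> complex" where
  "dirichlet d z = (\<Sum>k = - int d..int d. z powi k)"

lemma trig_poly_dirichlet: "trig_poly d (\<lambda>z. dirichlet d (z * w))"
proof -
  have "trig_poly d (\<lambda>z. \<Sum>k = - int d..int d. w powi k * z powi k)"
    by (intro trig_poly_sum trig_poly_cmult trig_poly_powi) auto
  then show ?thesis
    unfolding dirichlet_def power_int_mult_distrib by (simp add: mult.commute)
qed

text \<open>Sampling at more than \<open>N + d\<close> roots of unity computes the partial Fourier sum without aliasing.\<close>

lemma discrete_partial_sum: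
  assumes d: "d \<le> N" "N + d < M" and z: "cmod z = 1"
    and f: "\<And>z. cmod z = 1 \<Longrightarrow> f z = (\<Sum>k = - int N..int N. c k * z powi k)"
  shows "(\<Sum>j<M. f (unity_root M j) * dirichlet d (z * cnj (unity_root M j)))
     = of_nat M * (\<Sum>k = - int d..int d. c k * z powi k)"
proof -
  have "(\<Sum>j<M. f (unity_root M j) * dirichlet d (z * cnj (unity_root M j)))
      = (\<Sum>j<M. \<Sum>l = - int d..int d. \<Sum>k = - int N..int N. c k * z powi l * unity_root M j powi (k - l))"
    by (subst sum.swap)
      (simp add: f dirichlet_def sum_product cnj_eq_inverse power_int_mult_distrib power_int_inverse
        power_int_diff divide_inverse mult_ac)
  also have "\<dots> = (\<Sum>l = - int d..int d. \<Sum>k = - int N..int N. \<Sum>j<M. c k * z powi l * unity_root M j powi (k - l))"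
    by (simp add: sum.swap[of _ "{..<M}"])
  also have "\<dots> = (\<Sum>l = - int d..int d. \<Sum>k = - int N..int N. if k = l then of_nat M * (c l * z powi l) else 0)"
  proof (intro sum.cong refl)
    fix l k assume l: "l \<in> {- int d..int d}" and k: "k \<in> {- int N..int N}"
    \<comment> \<open>Here |k - l| <= N + d < M, so 0 is the only multiple of M that can
      occur.\<close>
    have "int M dvd k - l \<longleftrightarrow> k = l"
      using l k d zdvd_imp_le[of "int M" "\<bar>k - l\<bar>"] by (cases "k = l") auto
    then show "(\<Sum>j<M. c k * z powi l * unity_root M j powi (k - l))
        = (if k = l then of_nat M * (c l * z powi l) else 0)"
      using d by (simp add: sum_unity_root_powi flip: sum_distrib_left)
  qed
  also have "\<dots> = (\<Sum>l = - int d..int d. of_nat M * (c l * z powi l))"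
    using d by (intro sum.cong refl) (auto simp: sum.delta)
  finally show ?thesis by (simp add: sum_distrib_left)
qed

text \<open>The case N = d, where the partial sum is the polynomial itself. As an interpolation
  formula it serves three times: for completeness, for cardinality and for the projection in the
  upper bound.\<close>

lemma discrete_reproduction:
  assumes "trig_poly d f" "2 * d < M" "cmod z = 1"
  shows "f z = (\<Sum>j<M. f (unity_root M j) * (dirichlet d (z * cnj (unity_root M j)) / of_nat M))"
proof -
  obtain c where c: "\<And>z. cmod z = 1 \<Longrightarrow> f z = (\<Sum>k = - int d..int d. c k * z powi k)"
    using assms unfolding trig_poly_def by blast
  show ?thesis
    using discrete_partial_sum[of d d M z f c] assms c by (simp flip: sum_divide_distrib)
qed

lemma trig_poly_kernel_sum:
  "trig_poly d (\<lambda>z. \<Sum>j<M. a j * (dirichlet d (z * cnj (unity_root M j)) / of_nat M))"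
proof -
  have "trig_poly d (\<lambda>z. \<Sum>j<M. (a j / of_nat M) * dirichlet d (z * cnj (unity_root M j)))"
    by (intro trig_poly_sum trig_poly_cmult trig_poly_dirichlet)
  then show ?thesis by simp
qed

text \<open>The interpolation formula involves finitely many samples and therefore passes to
  pointwise limits, which are then kernel sums again.\<close>

lemma complex_banach_space_Trig: "complex_banach_space (Trig d)"
proof -
  interpret function_space "sphere 0 1" "{\<lambda>z\<in>sphere 0 1. h z | h. trig_poly d h}"
    by (rule function_space_Trig)
  show ?thesis
    unfolding Trig_eq
  proof (rule complex_banach_space)
    fix \<sigma> :: "nat \<Rightarrow> complex \<Rightarrow> complex" and g
    assume \<sigma>: "\<And>n. \<sigma> n \<in> {\<lambda>z\<in>sphere 0 1. h z | h. trig_poly d h}"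
      and g: "g \<in> extensional (sphere 0 1)" "\<And>z. z \<in> sphere 0 1 \<Longrightarrow> (\<lambda>n. \<sigma> n z) \<longlonglongrightarrow> g z"
    let ?M = "Suc (2 * d)"
    let ?S = "\<lambda>f z. \<Sum>j<?M. f (unity_root ?M j) * (dirichlet d (z * cnj (unity_root ?M j)) / of_nat ?M)"
    have eq: "\<sigma> n z = ?S (\<sigma> n) z" if "cmod z = 1" for n z
    proof -
      obtain h where "\<sigma> n = (\<lambda>z\<in>sphere 0 1. h z)" "trig_poly d h" using \<sigma>[of n] by blast
      then show ?thesis
        using discrete_reproduction[of d h ?M z] that by (simp del: of_nat_Suc)
    qed
    have rep: "g z = ?S g z" if z: "cmod z = 1" for z
    proof (rule LIMSEQ_unique)
      show "(\<lambda>n. \<sigma> n z) \<longlonglongrightarrow> g z" using g z by simp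
      show "(\<lambda>n. \<sigma> n z) \<longlonglongrightarrow> ?S g z"
        unfolding eq[OF z] by (intro tendsto_intros g) simp_all
    qed
    have "g = (\<lambda>z\<in>sphere 0 1. ?S g z)"
    proof (rule extensionalityI[OF g(1) restrict_extensional])
      fix z :: complex assume z: "z \<in> sphere 0 1"
      show "g z = (\<lambda>z\<in>sphere 0 1. ?S g z) z"
        unfolding restrict_apply'[OF z] by (rule rep) (use z in simp)
    qed
    moreover have "trig_poly d (?S g)"
      by (rule trig_poly_kernel_sum)
    ultimately show "g \<in> {\<lambda>z\<in>sphere 0 1. h z | h. trig_poly d h}" by blast
  qed
qed

text \<open>By interpolation the samples at 2 d + 1 roots of unity determine the polynomial, so the
  space embeds into the complex sequences.\<close>

lemma Trig_injects_reals: "\<exists>h :: (complex \<Rightarrow> complex) \<Rightarrow> real. inj_on h (carrier (Trig d))"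
proof -
  obtain h :: "(nat \<Rightarrow> complex) \<Rightarrow> real" where h: "inj h" using complex_sequences_inject_reals by blast
  let ?M = "Suc (2 * d)"
  have "inj_on (\<lambda>f j. f (unity_root ?M j)) (carrier (Trig d))"
  proof (rule inj_onI)
    fix f g assume "f \<in> carrier (Trig d)" "g \<in> carrier (Trig d)"
    then obtain f' g' where fg: "f = (\<lambda>z\<in>sphere 0 1. f' z)" "trig_poly d f'"
      "g = (\<lambda>z\<in>sphere 0 1. g' z)" "trig_poly d g'" by (auto simp: carrier_Trig)
    assume "(\<lambda>j. f (unity_root ?M j)) = (\<lambda>j. g (unity_root ?M j))"
    then have "f' (unity_root ?M j) = g' (unity_root ?M j)" for j using fg by (auto simp: fun_eq_iff)
    then have "f' z = g' z" if "cmod z = 1" for z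
      using discrete_reproduction[OF fg(2), of ?M z] discrete_reproduction[OF fg(4), of ?M z] that by simp
    then show "f = g" using fg by (auto intro!: restrict_ext)
  qed
  then have "inj_on (h \<circ> (\<lambda>f j. f (unity_root ?M j))) (carrier (Trig d))"
    using h by (intro comp_inj_on) (auto intro: inj_on_subset)
  then show ?thesis by blast
qed

section \<open>Lebesgue constants\<close>

definition lebesgue_const :: "nat \<Rightarrow> real" where
  "lebesgue_const d = 1 / (2 * pi) *
     integral {0..2 * pi} (\<lambda>t. \<bar>sin ((real d + 1 / 2) * t) / sin (t / 2)\<bar>)"

lemma sum_symmetric_Suc:
  fixes f :: "int \<Rightarrow> 'a::comm_monoid_add"
  shows "(\<Sum>k = - int (Suc d)..int (Suc d). f k)
    = (\<Sum>k = - int d..int d. f k) + (f (int (Suc d)) + f (- int (Suc d)))"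
proof -
  have "{- int (Suc d)..int (Suc d)} = insert (int (Suc d)) (insert (- int (Suc d)) {- int d..int d})"
    by auto
  then show ?thesis by (simp add: add_ac)
qed

text \<open>The product form stays valid where the sine vanishes. Raising d by one adds 2 cos((d+1)
  t), and 2 cos a sin b = sin(a+b) - sin(a-b) telescopes.\<close>

lemma dirichlet_times_sin:
  "dirichlet d (cis t) * of_real (sin (t / 2)) = of_real (sin ((real d + 1 / 2) * t))"
proof (induction d)
  case (Suc d)
  have "cis t powi (int (Suc d)) + cis t powi (- int (Suc d)) = of_real (2 * cos ((real d + 1) * t))"
    unfolding cis_power_int of_int_minus mult_minus_left of_int_of_nat_eq
    by (simp add: complex_eq_iff add.commute del: minus_mult_left)
  then have "dirichlet (Suc d) (cis t) = dirichlet d (cis t) + of_real (2 * cos ((real d + 1) * t))"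
    by (simp only: dirichlet_def sum_symmetric_Suc)
  then have "dirichlet (Suc d) (cis t) * of_real (sin (t / 2))
      = of_real (sin ((real d + 1 / 2) * t) + 2 * cos ((real d + 1) * t) * sin (t / 2))"
    using Suc by (simp add: algebra_simps)
  also have "sin ((real d + 1 / 2) * t) + 2 * cos ((real d + 1) * t) * sin (t / 2)
      = sin ((real (Suc d) + 1 / 2) * t)"
    using sin_add[of "(real d + 1) * t" "t / 2"] sin_diff[of "(real d + 1) * t" "t / 2"]
    by (simp add: algebra_simps)
  finally show ?case .
qed (simp add: dirichlet_def)

text \<open>Defined from the finite sum instead of the quotient of sines, it is continuous across
  the removable singularities at the multiples of 2 pi.\<close>

definition abs_dirichlet :: "nat \<Rightarrow> real \<Rightarrow> real" where
  "abs_dirichlet d t = cmod (dirichlet d (cis t))"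

lemma abs_dirichlet_nonneg: "0 \<le> abs_dirichlet d t"
  by (simp add: abs_dirichlet_def)

lemma abs_dirichlet_times_sin:
  "abs_dirichlet d t * \<bar>sin (t / 2)\<bar> = \<bar>sin ((real d + 1 / 2) * t)\<bar>"
  using arg_cong[OF dirichlet_times_sin[of d t], of cmod]
  by (simp add: abs_dirichlet_def norm_mult)

lemma abs_dirichlet_le: "abs_dirichlet d t \<le> 2 * real d + 1"
proof -
  have "abs_dirichlet d t \<le> (\<Sum>k = - int d..int d. cmod (cis t powi k))"
    unfolding abs_dirichlet_def dirichlet_def by (rule norm_sum)
  also have "\<dots> = 2 * real d + 1" by (simp add: norm_power_int)
  finally show ?thesis .
qed

lemma abs_dirichlet_periodic: "abs_dirichlet d (t + 2 * pi) = abs_dirichlet d t"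
  by (simp add: abs_dirichlet_def flip: cis_mult)

lemma abs_dirichlet_minus: "abs_dirichlet d (- t) = abs_dirichlet d t"
proof -
  have "dirichlet d (cis (- t)) = (\<Sum>k = - int d..int d. cis t powi (- k))"
    by (simp add: dirichlet_def cis_power_int)
  also have "\<dots> = dirichlet d (cis t)"
    unfolding dirichlet_def by (rule sum.reindex_bij_witness[of _ uminus uminus]) auto
  finally show ?thesis by (simp add: abs_dirichlet_def)
qed

text \<open>A chord is at most as long as its arc, so the exponential of frequency k has Lipschitz
  constant |k|.\<close>

lemma abs_dirichlet_Lipschitz:
  "\<bar>abs_dirichlet d s - abs_dirichlet d t\<bar> \<le> (\<Sum>k = - int d..int d. \<bar>real_of_int k\<bar>) * \<bar>s - t\<bar>"
proof -
  have cis_diff: "cmod (cis a - cis b) \<le> \<bar>a - b\<bar>" for a b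
  proof -
    have "cis a - cis b = cis b * (cis (a - b) - 1)"
      by (simp add: right_diff_distrib cis_mult)
    then have "cmod (cis a - cis b) = 2 * \<bar>sin ((a - b) / 2)\<bar>"
      using dist_exp_i_1[of "a - b"] by (simp add: norm_mult cis_conv_exp)
    also have "\<dots> \<le> \<bar>a - b\<bar>" using abs_sin_x_le_abs_x[of "(a - b) / 2"] by simp
    finally show ?thesis .
  qed
  have "\<bar>abs_dirichlet d s - abs_dirichlet d t\<bar> \<le> cmod (dirichlet d (cis s) - dirichlet d (cis t))"
    unfolding abs_dirichlet_def by (rule norm_triangle_ineq3)
  also have "\<dots> \<le> (\<Sum>k = - int d..int d. cmod (cis (of_int k * s) - cis (of_int k * t)))"
    unfolding dirichlet_def cis_power_int sum_subtractf[symmetric] by (rule norm_sum)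
  also have "\<dots> \<le> (\<Sum>k = - int d..int d. \<bar>real_of_int k\<bar> * \<bar>s - t\<bar>)"
  proof (rule sum_mono)
    fix k :: int
    show "cmod (cis (of_int k * s) - cis (of_int k * t)) \<le> \<bar>real_of_int k\<bar> * \<bar>s - t\<bar>"
      using cis_diff[of "of_int k * s" "of_int k * t"]
      by (simp add: abs_mult[symmetric] right_diff_distrib)
  qed
  finally show ?thesis by (simp add: sum_distrib_right)
qed

lemma continuous_on_abs_dirichlet: "continuous_on A (abs_dirichlet d)"
  unfolding abs_dirichlet_def[abs_def] dirichlet_def by (intro continuous_intros) auto

lemma abs_dirichlet_integrable: "abs_dirichlet d integrable_on {a..b}"
  by (intro integrable_continuous_real continuous_on_abs_dirichlet)

lemma lebesgue_const_eq: "lebesgue_const d = 1 / (2 * pi) * integral {0..2 * pi} (abs_dirichlet d)"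
proof -
  \<comment> \<open>The integrands differ at the two endpoints only: there the quotient is 0 by the
    convention on division by zero, while the kernel has modulus 2 d + 1.\<close>
  have "integral {0..2 * pi} (\<lambda>t. \<bar>sin ((real d + 1 / 2) * t) / sin (t / 2)\<bar>)
      = integral {0..2 * pi} (abs_dirichlet d)"
  proof (rule integral_spike[of "{0, 2 * pi}"])
    fix t assume "t \<in> {0..2 * pi} - {0, 2 * pi}"
    then have "sin (t / 2) > 0" by (intro sin_gt_zero) auto
    then show "abs_dirichlet d t = \<bar>sin ((real d + 1 / 2) * t) / sin (t / 2)\<bar>"
      using abs_dirichlet_times_sin[of d t] by (simp add: field_simps)
  qed simp
  then show ?thesis by (simp add: lebesgue_const_def)
qed

section \<open>Riemann sums of the kernel with a uniform rate\<close>

lemma integral_period_shift: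
  fixes g :: "real \<Rightarrow> real"
  assumes cont: "\<And>A. continuous_on A g" and per: "\<And>t. g (t + p) = g t" and \<theta>: "0 \<le> \<theta>" "\<theta> \<le> p"
  shows "integral {\<theta>..\<theta> + p} g = integral {0..p} g"
proof -
  have int: "g integrable_on {a..b}" for a b by (intro integrable_continuous_real cont)
  have "integral {\<theta>..\<theta> + p} g = integral {\<theta>..p} g + integral {p..\<theta> + p} g"
    using \<theta> by (intro Henstock_Kurzweil_Integration.integral_combine[symmetric] int) auto
  also have "integral {p..\<theta> + p} g = integral {0..\<theta>} (g \<circ> ((+) p))"
    using Henstock_Kurzweil_Integration.integral_shift_Icc_real[of 0 \<theta> g p] by simp
  also have "g \<circ> ((+) p) = g" using per by (auto simp: fun_eq_iff add.commute)
  also have "integral {\<theta>..p} g + integral {0..\<theta>} g = integral {0..p} g"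
    using \<theta> Henstock_Kurzweil_Integration.integral_combine[of 0 \<theta> p g] int by simp
  finally show ?thesis .
qed

text \<open>On one cell of length h the function departs from its left value by at most K h, which
  costs at most \<open>K * h\<^sup>2\<close> per cell.\<close>

lemma Riemann_sum_Lipschitz:
  fixes g :: "real \<Rightarrow> real"
  assumes cont: "\<And>A. continuous_on A g" and lip: "\<And>s t. \<bar>g s - g t\<bar> \<le> K * \<bar>s - t\<bar>" and h: "h \<ge> 0"
  shows "\<bar>h * (\<Sum>j<n. g (\<theta> + real j * h)) - integral {\<theta>..\<theta> + real n * h} g\<bar> \<le> real n * (K * h\<^sup>2)"
proof (induction n)
  case (Suc n)
  have int: "g integrable_on {a..b}" for a b by (intro integrable_continuous_real cont)
  have K: "K \<ge> 0" using lip[of 0 1] by simp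
  let ?a = "\<theta> + real n * h"
  have split: "integral {\<theta>..\<theta> + real (Suc n) * h} g = integral {\<theta>..?a} g + integral {?a..?a + h} g"
    using h Henstock_Kurzweil_Integration.integral_combine[of \<theta> ?a "?a + h" g] int
    by (simp add: algebra_simps)
  have "integral {?a..?a + h} (\<lambda>t. g ?a) - integral {?a..?a + h} g = integral {?a..?a + h} (\<lambda>t. g ?a - g t)"
    by (rule Henstock_Kurzweil_Integration.integral_diff[symmetric]) (auto intro: int)
  then have "h * g ?a - integral {?a..?a + h} g = integral {?a..?a + h} (\<lambda>t. g ?a - g t)"
    using h by simp
  moreover have "norm (integral {?a..?a + h} (\<lambda>t. g ?a - g t)) \<le> (K * h) * (?a + h - ?a)"
  proof (rule integral_bound)
    show "continuous_on {?a..?a + h} (\<lambda>t. g ?a - g t)" by (intro continuous_intros cont)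
    fix t assume "t \<in> {?a..?a + h}"
    then have "K * \<bar>?a - t\<bar> \<le> K * h" using K by (intro mult_left_mono) auto
    then show "norm (g ?a - g t) \<le> K * h" using lip[of ?a t] by simp
  qed (use h in simp)
  ultimately have "\<bar>h * g ?a - integral {?a..?a + h} g\<bar> \<le> K * h\<^sup>2"
    by (simp add: power2_eq_square mult.assoc)
  then show ?case
    using Suc unfolding split by (simp add: algebra_simps abs_le_iff)
qed simp

lemma cmod_1_eq_cis:
  assumes "cmod z = 1"
  obtains t where "0 \<le> t" "t \<le> 2 * pi" "z = cis t"
proof -
  have "(Re z)\<^sup>2 + (Im z)\<^sup>2 = 1" using assms by (simp add: cmod_def)
  then obtain t where "0 \<le> t" "t < 2 * pi" "Re z = cos t" "Im z = sin t" by (rule sincos_total_2pi)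
  then show thesis by (intro that[of t]) (auto simp: complex_eq_iff)
qed

text \<open>A rotation by \<open>z\<close> merely shifts the sampling grid within a period, so
  \<open>K\<close> can be chosen independently of \<open>z\<close>. This uniformity turns the
  estimate into a bound for operator norms.\<close>

lemma lebesgue_const_Riemann_sum:
  obtains K where "\<And>M z. M > 0 \<Longrightarrow> cmod z = 1 \<Longrightarrow>
    \<bar>(\<Sum>j<M. cmod (dirichlet d (z * cnj (unity_root M j)))) / real M - lebesgue_const d\<bar> \<le> K / real M"
proof
  define K where "K = (\<Sum>k = - int d..int d. \<bar>real_of_int k\<bar>)"
  fix M :: nat and z :: complex assume M: "M > 0" and z: "cmod z = 1"
  \<comment> \<open>The conjugate is parametrised because the sampling angles are then -(\<theta> +
    j h); the evenness of the modulus removes the sign.\<close>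
  obtain \<theta> where \<theta>: "0 \<le> \<theta>" "\<theta> \<le> 2 * pi" "cnj z = cis \<theta>"
    using cmod_1_eq_cis[of "cnj z"] z by auto
  define h where "h = 2 * pi / real M"
  have Mh: "real M * h = 2 * pi" using M by (simp add: h_def)
  have "z = cis (- \<theta>)" using \<theta>(3) by (metis complex_cnj_cnj cis_cnj)
  then have "z * cnj (unity_root M j) = cis (- (\<theta> + real j * h))" for j
    by (simp add: unity_root_def cis_cnj cis_mult h_def algebra_simps)
  then have eq: "cmod (dirichlet d (z * cnj (unity_root M j))) = abs_dirichlet d (\<theta> + real j * h)" for j
    using abs_dirichlet_minus[of d "\<theta> + real j * h"] by (simp add: abs_dirichlet_def)
  have "\<bar>h * (\<Sum>j<M. abs_dirichlet d (\<theta> + real j * h)) - integral {\<theta>..\<theta> + real M * h} (abs_dirichlet d)\<bar>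
      \<le> real M * (K * h\<^sup>2)"
    using abs_dirichlet_Lipschitz[of d] unfolding K_def h_def
    by (intro Riemann_sum_Lipschitz continuous_on_abs_dirichlet) auto
  also have "integral {\<theta>..\<theta> + real M * h} (abs_dirichlet d) = integral {0..2 * pi} (abs_dirichlet d)"
    unfolding Mh using \<theta> by (intro integral_period_shift continuous_on_abs_dirichlet abs_dirichlet_periodic)
  also have "\<dots> = 2 * pi * lebesgue_const d" by (simp add: lebesgue_const_eq)
  \<comment> \<open>With h = 2 pi/M the M cell errors add up to a multiple of 1/M. One factor 2 pi
    is split off to cancel against the normalisation of the Lebesgue constant.\<close>
  also have "real M * (K * h\<^sup>2) = 2 * pi * (2 * pi * K / real M)"
    using M by (simp add: h_def power2_eq_square)
  also have "h * (\<Sum>j<M. abs_dirichlet d (\<theta> + real j * h))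
      = 2 * pi * ((\<Sum>j<M. abs_dirichlet d (\<theta> + real j * h)) / real M)"
    by (simp add: h_def)
  finally have "2 * pi * \<bar>(\<Sum>j<M. abs_dirichlet d (\<theta> + real j * h)) / real M - lebesgue_const d\<bar>
      \<le> 2 * pi * (2 * pi * K / real M)"
    by (simp only: right_diff_distrib[symmetric] abs_mult) simp
  then have "\<bar>(\<Sum>j<M. abs_dirichlet d (\<theta> + real j * h)) / real M - lebesgue_const d\<bar> \<le> 2 * pi * K / real M"
    by (rule mult_left_le_imp_le) simp
  then show "\<bar>(\<Sum>j<M. cmod (dirichlet d (z * cnj (unity_root M j)))) / real M - lebesgue_const d\<bar>
      \<le> 2 * pi * K / real M"
    unfolding eq .
qed

section \<open>Logarithmic growth of the Lebesgue constants\<close>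

text \<open>The half-angle identity \<open>1 / sin x = (tan (x/2) + cot (x/2)) / 2\<close> reduces this to \<open>y \<le> tan y\<close>.\<close>

lemma inverse_sin_le:
  assumes x: "0 < x" "x \<le> pi / 2"
  shows "1 / sin x \<le> 1 / x + 1 / 2"
proof -
  define y where "y = x / 2"
  have y: "0 < y" "y \<le> pi / 4" using x by (auto simp: y_def)
  have s: "sin y > 0" and c: "cos y > 0" using y pi_gt_zero by (auto intro!: sin_gt_zero cos_gt_zero)
  have "sin 0 - 0 * cos 0 \<le> sin y - y * cos y"
  proof (rule DERIV_nonneg_imp_nondecreasing[OF less_imp_le[OF y(1)]])
    fix u assume u: "0 \<le> u" "u \<le> y"
    have "((\<lambda>u. sin u - u * cos u) has_real_derivative u * sin u) (at u)"
      by (auto intro!: derivative_eq_intros)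
    moreover have "u * sin u \<ge> 0" using u y by (intro mult_nonneg_nonneg sin_ge_zero) auto
    ultimately show "\<exists>D. ((\<lambda>u. sin u - u * cos u) has_real_derivative D) (at u) \<and> 0 \<le> D" by blast
  qed
  then have "cos y / sin y \<le> 1 / y" using s y by (simp add: field_simps)
  moreover have "sin y \<le> cos y"
  proof -
    have "sin y \<le> sin (pi / 2 - y)" using y by (intro sin_monotone_2pi_le) auto
    then show ?thesis by (simp add: sin_diff)
  qed
  then have "sin y / cos y \<le> 1" using c by simp
  moreover have "1 / sin x = (sin y / cos y + cos y / sin y) / 2"
  proof -
    have "sin x = 2 * sin y * cos y" using sin_double[of y] by (simp add: y_def)
    moreover have "sin y * sin y + cos y * cos y = 1"
      using sin_cos_squared_add[of y] by (simp add: power2_eq_square)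
    ultimately show ?thesis using s c by (simp add: field_simps)
  qed
  ultimately show ?thesis by (simp add: y_def)
qed

text \<open>In the variable n t/2 the interval is [k pi, (k+1) pi], where the sine has the sign
  (-1)^k and encloses area 2; the change of variable multiplies this by 2/n.\<close>

lemma abs_sin_arch_integral:
  fixes k d :: nat
  defines "n \<equiv> 2 * real d + 1"
  shows "((\<lambda>t. \<bar>sin ((real d + 1 / 2) * t)\<bar>) has_integral 4 / n)
    {2 * pi * real k / n..2 * pi * (real k + 1) / n}"
proof -
  have n: "n > 0" "real d + 1 / 2 = n / 2" by (auto simp: n_def)
  define F where "F t = (- ((- 1) ^ k)) * (2 / n) * cos (n / 2 * t)" for t
  have "((\<lambda>t. (- 1) ^ k * sin (n / 2 * t)) has_integral
      F (2 * pi * (real k + 1) / n) - F (2 * pi * real k / n))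
      {2 * pi * real k / n..2 * pi * (real k + 1) / n}"
  proof (rule fundamental_theorem_of_calculus)
    show "2 * pi * real k / n \<le> 2 * pi * (real k + 1) / n"
      using n by (simp add: divide_right_mono)
    show "(F has_vector_derivative (- 1) ^ k * sin (n / 2 * t))
      (at t within {2 * pi * real k / n..2 * pi * (real k + 1) / n})" for t
      unfolding F_def has_real_derivative_iff_has_vector_derivative[symmetric]
      using n by (auto intro!: derivative_eq_intros)
  qed
  moreover have "F (2 * pi * (real k + 1) / n) - F (2 * pi * real k / n) = 4 / n"
  proof -
    have "n / 2 * (2 * pi * (real k + 1) / n) = real (Suc k) * pi" "n / 2 * (2 * pi * real k / n) = real k * pi"
      using n by (simp_all add: field_simps)
    then have "cos (n / 2 * (2 * pi * (real k + 1) / n)) = - ((- 1) ^ k)"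
      "cos (n / 2 * (2 * pi * real k / n)) = (- 1) ^ k"
      by (simp_all only: cos_npi power_Suc)
    moreover have "(- 1) ^ k * (- 1) ^ k = (1 :: real)" by (simp flip: power_mult_distrib)
    ultimately show ?thesis unfolding F_def by (simp only:) (simp add: algebra_simps)
  qed
  moreover have sign: "(- 1) ^ k * sin (n / 2 * t) = \<bar>sin ((real d + 1 / 2) * t)\<bar>"
    if "t \<in> {2 * pi * real k / n..2 * pi * (real k + 1) / n}" for t
  proof -
    define u where "u = n / 2 * t - real k * pi"
    have "0 \<le> u" "u \<le> pi" using that n by (auto simp: u_def field_simps)
    then have "sin u \<ge> 0" by (rule sin_ge_zero)
    moreover have "n / 2 * t = u + real k * pi" by (simp add: u_def)
    then have "sin (n / 2 * t) = (- 1) ^ k * sin u"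
      by (simp only: sin_add sin_npi cos_npi) simp
    ultimately show ?thesis
      unfolding n(2) by (simp add: abs_mult flip: power_mult_distrib mult.assoc)
  qed
  ultimately have "((\<lambda>t. (- 1) ^ k * sin (n / 2 * t)) has_integral 4 / n)
      {2 * pi * real k / n..2 * pi * (real k + 1) / n}"
    by (simp only:)
  then show ?thesis by (rule has_integral_eq[rotated]) (rule sign)
qed

text \<open>On the k-th arch the denominator is frozen at an endpoint: sin(t/2) is at most the right
  end pi (k+1)/n of the range of t/2, and at least the sine of the left end pi k/n. For the latter,
  \<open>inverse_sin_le\<close> replaces the reciprocal sine by 1/x + 1/2, whose second term
  produces 2/n. The upper bound starts at k = 1, as the left end for k = 0 has sine 0.\<close>

lemma integral_abs_dirichlet_arch:
  fixes k d :: nat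
  defines "n \<equiv> 2 * real d + 1"
  defines "J \<equiv> {2 * pi * real k / n..2 * pi * (real k + 1) / n}"
  shows abs_dirichlet_arch_ge: "k < d \<Longrightarrow> 4 / (pi * (real k + 1)) \<le> integral J (abs_dirichlet d)"
    and abs_dirichlet_arch_le: "0 < k \<Longrightarrow> k < d \<Longrightarrow> integral J (abs_dirichlet d) \<le> 4 / (pi * real k) + 2 / n"
proof -
  have n: "n > 0" by (simp add: n_def)
  have arch: "((\<lambda>t. \<bar>sin ((real d + 1 / 2) * t)\<bar>) has_integral 4 / n) J"
    unfolding J_def n_def by (rule abs_sin_arch_integral)
  have int: "abs_dirichlet d integrable_on J" unfolding J_def by (rule abs_dirichlet_integrable)
  have half: "pi * real k / n \<le> t / 2" "t / 2 \<le> pi * (real k + 1) / n" if "t \<in> J" for t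
  proof -
    have eq: "pi * real k / n = (2 * pi * real k / n) / 2"
      "pi * (real k + 1) / n = (2 * pi * (real k + 1) / n) / 2"
      by simp_all
    have t: "2 * pi * real k / n \<le> t" "t \<le> 2 * pi * (real k + 1) / n"
      using that by (simp_all only: J_def atLeastAtMost_iff)
    show "pi * real k / n \<le> t / 2" unfolding eq using t(1) by (rule divide_right_mono) simp
    show "t / 2 \<le> pi * (real k + 1) / n" unfolding eq using t(2) by (rule divide_right_mono) simp
  qed
  \<comment> \<open>From k < d it follows that 2 (k+1) <= 2 d < n, so the half-angle stays where the
    sine increases.\<close>
  have top: "pi * (real k + 1) / n \<le> pi / 2" if "k < d"
  proof -
    have "pi * (2 * (real k + 1)) \<le> pi * n" using that by (intro mult_left_mono) (auto simp: n_def)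
    then show ?thesis using n by (simp add: field_simps)
  qed
  {
    assume kd: "k < d"
    let ?s = "pi * (real k + 1) / n"
    have s: "?s > 0" using n by simp
    have "((\<lambda>t. 1 / ?s * \<bar>sin ((real d + 1 / 2) * t)\<bar>) has_integral 1 / ?s * (4 / n)) J"
      by (rule has_integral_mult_right[OF arch])
    moreover have "1 / ?s * \<bar>sin ((real d + 1 / 2) * t)\<bar> \<le> abs_dirichlet d t" if t: "t \<in> J" for t
    proof -
      have "0 \<le> t / 2" using half(1)[OF t] n by (smt (verit) divide_nonneg_nonneg mult_nonneg_nonneg of_nat_0_le_iff pi_ge_zero)
      then have "\<bar>sin (t / 2)\<bar> \<le> ?s" using half(2)[OF t] abs_sin_x_le_abs_x[of "t / 2"] by linarith
      then have "abs_dirichlet d t * \<bar>sin (t / 2)\<bar> \<le> abs_dirichlet d t * ?s"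
        by (intro mult_left_mono abs_dirichlet_nonneg)
      then have "\<bar>sin ((real d + 1 / 2) * t)\<bar> / ?s \<le> abs_dirichlet d t"
        unfolding abs_dirichlet_times_sin pos_divide_le_eq[OF s] .
      then show ?thesis by (simp only: times_divide_eq_left mult_1_left)
    qed
    ultimately have "1 / ?s * (4 / n) \<le> integral J (abs_dirichlet d)"
      using int by (intro has_integral_le[OF _ integrable_integral])
    moreover have "1 / ?s * (4 / n) = 4 / (pi * (real k + 1))" using n by (simp add: field_simps)
    ultimately show "4 / (pi * (real k + 1)) \<le> integral J (abs_dirichlet d)" by simp
  }
  {
    assume k: "0 < k" and kd: "k < d"
    let ?x = "pi * real k / n"
    have "?x \<le> pi * (real k + 1) / n" using n by (intro divide_right_mono) auto
    then have x2: "?x \<le> pi / 2" using top[OF kd] by (rule order_trans)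
    have x1: "0 < ?x" using n k by simp
    note x = x1 x2
    have s: "sin ?x > 0" using x pi_gt_zero by (intro sin_gt_zero) linarith+
    have "((\<lambda>t. 1 / sin ?x * \<bar>sin ((real d + 1 / 2) * t)\<bar>) has_integral 1 / sin ?x * (4 / n)) J"
      by (rule has_integral_mult_right[OF arch])
    moreover have "abs_dirichlet d t \<le> 1 / sin ?x * \<bar>sin ((real d + 1 / 2) * t)\<bar>" if t: "t \<in> J" for t
    proof -
      have "sin ?x \<le> sin (t / 2)"
        using half[OF t] top[OF kd] x by (intro sin_monotone_2pi_le) auto
      then have "abs_dirichlet d t * sin ?x \<le> abs_dirichlet d t * \<bar>sin (t / 2)\<bar>"
        by (intro mult_left_mono abs_dirichlet_nonneg) auto
      then have "abs_dirichlet d t \<le> \<bar>sin ((real d + 1 / 2) * t)\<bar> / sin ?x"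
        unfolding abs_dirichlet_times_sin pos_le_divide_eq[OF s] .
      then show ?thesis by (simp only: times_divide_eq_left mult_1_left)
    qed
    ultimately have "integral J (abs_dirichlet d) \<le> 1 / sin ?x * (4 / n)"
      using int by (intro has_integral_le[OF integrable_integral])
    also have "\<dots> \<le> (1 / ?x + 1 / 2) * (4 / n)"
      using inverse_sin_le[OF x] n by (intro mult_right_mono) auto
    also have "\<dots> = 4 / (pi * real k) + 2 / n" using n k by (simp add: field_simps)
    finally show "integral J (abs_dirichlet d) \<le> 4 / (pi * real k) + 2 / n" .
  }
qed

text \<open>Periodicity and evenness fold the second half of the period onto the first, where the
  half-angle lies in [0, pi/2] and the sine is monotone.\<close>

lemma lebesgue_const_half: "lebesgue_const d = 1 / pi * integral {0..pi} (abs_dirichlet d)"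
proof -
  have "integral {pi..2 * pi} (abs_dirichlet d) = integral {- pi..0} (abs_dirichlet d \<circ> ((+) (2 * pi)))"
    using Henstock_Kurzweil_Integration.integral_shift_Icc_real[of "- pi" 0 "abs_dirichlet d" "2 * pi"] by simp
  also have "abs_dirichlet d \<circ> ((+) (2 * pi)) = (\<lambda>t. abs_dirichlet d (- t))"
    using abs_dirichlet_periodic[of d] by (auto simp: fun_eq_iff add.commute abs_dirichlet_minus)
  also have "integral {- pi..0} (\<lambda>t. abs_dirichlet d (- t)) = integral {0..pi} (abs_dirichlet d)"
    using Henstock_Kurzweil_Integration.integral_reflect_real[of pi 0 "abs_dirichlet d"] by simp
  finally have "integral {0..2 * pi} (abs_dirichlet d) = 2 * integral {0..pi} (abs_dirichlet d)"
    using Henstock_Kurzweil_Integration.integral_combine[of 0 pi "2 * pi" "abs_dirichlet d"]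
      abs_dirichlet_integrable by simp
  then show ?thesis by (simp add: lebesgue_const_eq)
qed

text \<open>The first d arches fit into [0, pi], since 2 pi d/n < pi, and their lower bounds add up
  to a harmonic sum.\<close>

lemma lebesgue_const_ge: "4 / pi\<^sup>2 * harm d \<le> lebesgue_const d"
proof -
  define n where "n = 2 * real d + 1"
  have n: "n > 0" by (simp add: n_def)
  have "4 / pi * harm m \<le> integral {0..2 * pi * real m / n} (abs_dirichlet d)" if "m \<le> d" for m
    using that
  proof (induction m)
    case (Suc m)
    have "4 / (pi * (real m + 1)) \<le> integral {2 * pi * real m / n..2 * pi * (real m + 1) / n} (abs_dirichlet d)"
      unfolding n_def using Suc.prems by (intro abs_dirichlet_arch_ge) simp
    moreover have "integral {0..2 * pi * real m / n} (abs_dirichlet d)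
        + integral {2 * pi * real m / n..2 * pi * (real m + 1) / n} (abs_dirichlet d)
        = integral {0..2 * pi * (real m + 1) / n} (abs_dirichlet d)"
      using n by (intro Henstock_Kurzweil_Integration.integral_combine abs_dirichlet_integrable)
        (auto simp: divide_right_mono)
    moreover have "4 / pi * harm (Suc m) = 4 / pi * harm m + 4 / (pi * (real m + 1))"
      by (simp add: harm_Suc distrib_left inverse_eq_divide add.commute)
    ultimately show ?case using Suc by (simp add: add.commute)
  qed (simp add: harm_def)
  then have "4 / pi * harm d \<le> integral {0..2 * pi * real d / n} (abs_dirichlet d)" by simp
  also have "\<dots> \<le> integral {0..pi} (abs_dirichlet d)"
    using n by (intro integral_subset_le abs_dirichlet_integrable)
      (auto simp: abs_dirichlet_nonneg n_def field_simps intro: order_trans)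
  finally have "1 / pi * (4 / pi * harm d) \<le> lebesgue_const d"
    unfolding lebesgue_const_half by (intro mult_left_mono) auto
  then show ?thesis by (simp add: power2_eq_square)
qed

text \<open>Three pieces of [0, pi]: the trivial bound n gives 2 pi on arch 0 and pi on the final
  piece of length pi/n; arches 1 to d - 1 give the harmonic sum and at most 1 from the terms 2/n.
  The total excess 3 pi + 1 is at most 4 pi, and division by pi leaves 4.\<close>

lemma lebesgue_const_le:
  assumes "d \<ge> 1"
  shows "lebesgue_const d \<le> 4 / pi\<^sup>2 * harm d + 4"
proof -
  define n where "n = 2 * real d + 1"
  have n: "n > 0" by (simp add: n_def)
  have trivial_bound: "integral {a..b} (abs_dirichlet d) \<le> n * (b - a)" if "a \<le> b" for a b
    using integral_bound[of a b "abs_dirichlet d" n] that continuous_on_abs_dirichlet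
      abs_dirichlet_le[of d] abs_dirichlet_nonneg by (auto simp: n_def)
  have "integral {0..2 * pi * (real m + 1) / n} (abs_dirichlet d) \<le> 2 * pi + 4 / pi * harm m + real m * (2 / n)"
    if "m < d" for m
    using that
  proof (induction m)
    case 0
    show ?case using trivial_bound[of 0 "2 * pi / n"] n by (simp add: harm_def)
  next
    case (Suc m)
    have "integral {2 * pi * real (Suc m) / n..2 * pi * (real (Suc m) + 1) / n} (abs_dirichlet d)
        \<le> 4 / (pi * real (Suc m)) + 2 / n"
      unfolding n_def using Suc.prems by (intro abs_dirichlet_arch_le) auto
    moreover have "integral {0..2 * pi * real (Suc m) / n} (abs_dirichlet d)
        + integral {2 * pi * real (Suc m) / n..2 * pi * (real (Suc m) + 1) / n} (abs_dirichlet d)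
        = integral {0..2 * pi * (real (Suc m) + 1) / n} (abs_dirichlet d)"
      using n by (intro Henstock_Kurzweil_Integration.integral_combine abs_dirichlet_integrable)
        (auto simp: divide_right_mono)
    moreover have "4 / pi * harm (Suc m) = 4 / pi * harm m + 4 / (pi * real (Suc m))"
      by (simp add: harm_Suc distrib_left inverse_eq_divide add.commute)
    moreover have "real (Suc m) * (2 / n) = real m * (2 / n) + 2 / n" by (simp add: algebra_simps add_divide_distrib)
    ultimately show ?case using Suc by (simp add: add.commute)
  qed
  from this[of "d - 1"] have "integral {0..2 * pi * real d / n} (abs_dirichlet d)
      \<le> 2 * pi + 4 / pi * harm (d - 1) + real (d - 1) * (2 / n)"
    using assms by (simp add: of_nat_diff)
  moreover have "harm (d - 1) \<le> (harm d :: real)"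
    using assms by (cases d) (auto simp: harm_Suc)
  then have "4 / pi * harm (d - 1) \<le> 4 / pi * harm d" by (intro mult_left_mono) auto
  moreover have "real (d - 1) * (2 / n) \<le> 1" using n by (simp add: n_def field_simps)
  moreover have "integral {2 * pi * real d / n..pi} (abs_dirichlet d) \<le> pi"
  proof -
    have "n * (pi - 2 * pi * real d / n) = pi" using n by (simp add: n_def field_simps)
    moreover have "2 * pi * real d / n \<le> pi" using n by (simp add: n_def field_simps)
    ultimately show ?thesis using trivial_bound[of "2 * pi * real d / n" pi] by metis
  qed
  moreover have "integral {0..2 * pi * real d / n} (abs_dirichlet d)
      + integral {2 * pi * real d / n..pi} (abs_dirichlet d) = integral {0..pi} (abs_dirichlet d)"
    using n by (intro Henstock_Kurzweil_Integration.integral_combine abs_dirichlet_integrable)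
      (auto simp: n_def field_simps)
  ultimately have "integral {0..pi} (abs_dirichlet d) \<le> 4 / pi * harm d + 4 * pi"
    using pi_gt3 by linarith
  then have "lebesgue_const d \<le> 1 / pi * (4 / pi * harm d + 4 * pi)"
    unfolding lebesgue_const_half by (intro mult_left_mono) auto
  then show ?thesis by (simp add: power2_eq_square algebra_simps)
qed

lemma lebesgue_const_asymptotics: "(\<lambda>d. lebesgue_const d / ln (real d)) \<longlonglongrightarrow> 4 / pi\<^sup>2"
proof (rule tendsto_sandwich)
  have bounds: "4 / pi\<^sup>2 * ln (real d) \<le> lebesgue_const d \<and> lebesgue_const d \<le> 4 / pi\<^sup>2 * (ln (real d) + 1) + 4"
    if d: "d > 1" for d
  proof
    have "ln (real d) \<le> ln (real d + 1)" using d by simp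
    then have "4 / pi\<^sup>2 * ln (real d) \<le> 4 / pi\<^sup>2 * harm d"
      using ln_le_harm[of d] by (intro mult_left_mono) (linarith, simp)
    then show "4 / pi\<^sup>2 * ln (real d) \<le> lebesgue_const d" using lebesgue_const_ge[of d] by linarith
    \<comment> \<open>The difference of the harmonic number and the logarithm decreases and equals 1
      at index 1.\<close>
    have "harm d \<le> ln (real d) + 1"
      using euler_mascheroni_sequence_decreasing[of 1 d] d by (simp add: harm_def)
    then have "4 / pi\<^sup>2 * harm d \<le> 4 / pi\<^sup>2 * (ln (real d) + 1)" by (intro mult_left_mono) auto
    then show "lebesgue_const d \<le> 4 / pi\<^sup>2 * (ln (real d) + 1) + 4"
      using lebesgue_const_le[of d] d by simp
  qed
  show "eventually (\<lambda>d. 4 / pi\<^sup>2 \<le> lebesgue_const d / ln (real d)) sequentially"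
    using eventually_gt_at_top[of 1] by eventually_elim (use bounds in \<open>simp add: pos_le_divide_eq\<close>)
  show "eventually (\<lambda>d. lebesgue_const d / ln (real d)
      \<le> (4 / pi\<^sup>2 * (ln (real d) + 1) + 4) / ln (real d)) sequentially"
    using eventually_gt_at_top[of 1] by eventually_elim (use bounds in \<open>simp add: divide_right_mono\<close>)
  show "(\<lambda>d. (4 / pi\<^sup>2 * (ln (real d) + 1) + 4) / ln (real d)) \<longlonglongrightarrow> 4 / pi\<^sup>2"
    by real_asymp
qed simp

section \<open>The polynomials on the circle are the trigonometric polynomials\<close>

lemma trig_poly_const: "trig_poly d (\<lambda>z. a)"
  using trig_poly_cmult[OF trig_poly_powi[of 0 d], of a] by simp

lemma trig_poly_Re: "trig_poly 1 (\<lambda>z. of_real (Re z))"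
proof -
  have "trig_poly 1 (\<lambda>z. 1 / 2 * (z powi 1 + z powi (- 1)))"
    by (intro trig_poly_cmult trig_poly_add trig_poly_powi) auto
  then show ?thesis
  proof (rule trig_poly_cong)
    fix z :: complex assume "cmod z = 1"
    then show "1 / 2 * (z powi 1 + z powi (- 1)) = of_real (Re z)"
      by (simp add: power_int_minus flip: cnj_eq_inverse) (simp add: complex_eq_iff)
  qed
qed

lemma trig_poly_Im: "trig_poly 1 (\<lambda>z. of_real (Im z))"
proof -
  have "trig_poly 1 (\<lambda>z. - \<i> / 2 * (z powi 1 + (- 1) * z powi (- 1)))"
    by (intro trig_poly_cmult trig_poly_add trig_poly_powi) auto
  then show ?thesis
  proof (rule trig_poly_cong)
    fix z :: complex assume "cmod z = 1"
    then show "- \<i> / 2 * (z powi 1 + (- 1) * z powi (- 1)) = of_real (Im z)"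
      by (simp add: power_int_minus flip: cnj_eq_inverse) (simp add: complex_eq_iff)
  qed
qed

lemma trig_poly_power: "trig_poly 1 f \<Longrightarrow> trig_poly n (\<lambda>z. f z ^ n)"
proof (induction n)
  case (Suc n)
  then show ?case using trig_poly_mult[of 1 f n "\<lambda>z. f z ^ n"] by simp
qed (simp add: trig_poly_const)

definition circle_poly :: "nat \<Rightarrow> (real ^ 2 \<Rightarrow> complex) \<Rightarrow> bool" where
  "circle_poly d h \<longleftrightarrow> (\<exists>c. \<forall>x. norm x = 1 \<longrightarrow> h x = (\<Sum>(i, j)\<in>{(i, j). i + j \<le> d}.
     c i j * complex_of_real (x $ 1) ^ i * complex_of_real (x $ 2) ^ j))"

lemma finite_degree_le: "finite {(i, j). i + j \<le> (d::nat)}"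
  by (rule finite_subset[of _ "{..d} \<times> {..d}"]) auto

lemma circle_poly_monomial:
  assumes "a + b \<le> d"
  shows "circle_poly d (\<lambda>x. complex_of_real (x $ 1) ^ a * complex_of_real (x $ 2) ^ b)"
  unfolding circle_poly_def
proof (intro exI allI impI)
  fix x :: "real ^ 2"
  let ?m = "\<lambda>(i, j). complex_of_real (x $ 1) ^ i * complex_of_real (x $ 2) ^ j"
  have "(\<Sum>(i, j)\<in>{(i, j). i + j \<le> d}. (if (i, j) = (a, b) then 1 else 0)
        * complex_of_real (x $ 1) ^ i * complex_of_real (x $ 2) ^ j)
      = (\<Sum>p\<in>{(i, j). i + j \<le> d}. if p = (a, b) then ?m p else 0)"
    by (intro sum.cong) (auto split: if_splits)
  also have "\<dots> = ?m (a, b)" using assms finite_degree_le by (subst sum.delta) auto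
  finally show "complex_of_real (x $ 1) ^ a * complex_of_real (x $ 2) ^ b =
      (\<Sum>(i, j)\<in>{(i, j). i + j \<le> d}. (if (i, j) = (a, b) then 1 else 0)
        * complex_of_real (x $ 1) ^ i * complex_of_real (x $ 2) ^ j)" by simp
qed

lemma circle_poly_add:
  assumes "circle_poly d f" "circle_poly d g"
  shows "circle_poly d (\<lambda>x. f x + g x)"
proof -
  obtain b c where "\<And>x. norm x = 1 \<Longrightarrow> f x = (\<Sum>(i, j)\<in>{(i, j). i + j \<le> d}.
     b i j * complex_of_real (x $ 1) ^ i * complex_of_real (x $ 2) ^ j)"
   "\<And>x. norm x = 1 \<Longrightarrow> g x = (\<Sum>(i, j)\<in>{(i, j). i + j \<le> d}.
     c i j * complex_of_real (x $ 1) ^ i * complex_of_real (x $ 2) ^ j)"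
    using assms unfolding circle_poly_def by blast
  then show ?thesis
    unfolding circle_poly_def
    by (intro exI[of _ "\<lambda>i j. b i j + c i j"])
      (simp add: sum.distrib[symmetric] case_prod_beta distrib_right)
qed

lemma circle_poly_cmult:
  assumes "circle_poly d f"
  shows "circle_poly d (\<lambda>x. a * f x)"
proof -
  obtain c where "\<And>x. norm x = 1 \<Longrightarrow> f x = (\<Sum>(i, j)\<in>{(i, j). i + j \<le> d}.
     c i j * complex_of_real (x $ 1) ^ i * complex_of_real (x $ 2) ^ j)"
    using assms unfolding circle_poly_def by blast
  then show ?thesis
    unfolding circle_poly_def
    by (intro exI[of _ "\<lambda>i j. a * c i j"])
      (simp add: sum_distrib_left case_prod_beta mult.assoc)
qed

lemma circle_poly_sum: "(\<And>k. k \<in> A \<Longrightarrow> circle_poly d (f k)) \<Longrightarrow> circle_poly d (\<lambda>x. \<Sum>k\<in>A. f k x)"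
proof (induction A rule: infinite_finite_induct)
  case (insert k A)
  then show ?case by (simp add: circle_poly_add)
qed (use circle_poly_cmult[OF circle_poly_monomial[of 0 0 d], of 0] in simp_all)

lemma circle_poly_cong: "circle_poly d f \<Longrightarrow> (\<And>x. norm x = 1 \<Longrightarrow> f x = g x) \<Longrightarrow> circle_poly d g"
  unfolding circle_poly_def by simp

text \<open>The values w = \<i> and w = -\<i> matter: they give the powers of z and of its
  conjugate, whose binomial expansions consist of monomials of degree k.\<close>

lemma circle_poly_linear_power:
  assumes "k \<le> d"
  shows "circle_poly d (\<lambda>x. (complex_of_real (x $ 1) + w * complex_of_real (x $ 2)) ^ k)"
proof -
  have "circle_poly d (\<lambda>x. \<Sum>i\<le>k. (of_nat (k choose i) * w ^ (k - i)) *
      (complex_of_real (x $ 1) ^ i * complex_of_real (x $ 2) ^ (k - i)))"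
    using assms by (intro circle_poly_sum circle_poly_cmult circle_poly_monomial) auto
  then show ?thesis
    by (rule circle_poly_cong) (simp add: binomial_ring power_mult_distrib mult_ac)
qed

definition plane_to_complex :: "real ^ 2 \<Rightarrow> complex" where
  "plane_to_complex x = Complex (x $ 1) (x $ 2)"

definition complex_to_plane :: "complex \<Rightarrow> real ^ 2" where
  "complex_to_plane z = vector [Re z, Im z]"

lemma plane_complex_inverse [simp]:
  "plane_to_complex (complex_to_plane z) = z" "complex_to_plane (plane_to_complex x) = x"
  by (simp_all add: plane_to_complex_def complex_to_plane_def vec_eq_iff forall_2)

lemma norm_plane_to_complex [simp]: "cmod (plane_to_complex x) = norm x"
  by (simp add: plane_to_complex_def norm_vec_def L2_set_def UNIV_2 cmod_def)

lemma norm_complex_to_plane [simp]: "norm (complex_to_plane z) = cmod z"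
  by (metis norm_plane_to_complex plane_complex_inverse(1))

lemma circle_poly_if_trig_poly:
  assumes "trig_poly d h"
  shows "circle_poly d (\<lambda>x. h (plane_to_complex x))"
proof -
  obtain c where c: "\<And>z. cmod z = 1 \<Longrightarrow> h z = (\<Sum>k = - int d..int d. c k * z powi k)"
    using assms unfolding trig_poly_def by blast
  have "circle_poly d (\<lambda>x. plane_to_complex x powi k)" if k: "\<bar>k\<bar> \<le> int d" for k
  proof (cases "k \<ge> 0")
    case True
    then have "circle_poly d (\<lambda>x. (complex_of_real (x $ 1) + \<i> * complex_of_real (x $ 2)) ^ nat k)"
      using k by (intro circle_poly_linear_power) auto
    then show ?thesis
      by (rule circle_poly_cong) (use True in \<open>simp add: plane_to_complex_def Complex_eq power_int_def\<close>)
  next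
    \<comment> \<open>On the circle the inverse is the conjugate, so a negative exponent k costs
      only degree |k|.\<close>
    case False
    then have "circle_poly d (\<lambda>x. (complex_of_real (x $ 1) + (- \<i>) * complex_of_real (x $ 2)) ^ nat (- k))"
      using k by (intro circle_poly_linear_power) auto
    then show ?thesis
    proof (rule circle_poly_cong)
      fix x :: "real ^ 2" assume "norm x = 1"
      then have "inverse (plane_to_complex x) = cnj (plane_to_complex x)"
        by (intro cnj_eq_inverse[symmetric]) simp
      also have "\<dots> = complex_of_real (x $ 1) + (- \<i>) * complex_of_real (x $ 2)"
        by (simp add: plane_to_complex_def complex_eq_iff)
      finally show "(complex_of_real (x $ 1) + (- \<i>) * complex_of_real (x $ 2)) ^ nat (- k)
          = plane_to_complex x powi k"
        using False by (simp add: power_int_def)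
    qed
  qed
  then have "circle_poly d (\<lambda>x. \<Sum>k = - int d..int d. c k * plane_to_complex x powi k)"
    by (intro circle_poly_sum circle_poly_cmult) auto
  then show ?thesis by (rule circle_poly_cong) (simp add: c)
qed

text \<open>On the circle Re z and Im z have trigonometric degree 1, and degrees add under
  multiplication.\<close>

lemma trig_poly_if_circle_poly:
  assumes "circle_poly d h"
  shows "trig_poly d (\<lambda>z. h (complex_to_plane z))"
proof -
  obtain c where c: "\<And>x. norm x = 1 \<Longrightarrow> h x = (\<Sum>(i, j)\<in>{(i, j). i + j \<le> d}.
     c i j * complex_of_real (x $ 1) ^ i * complex_of_real (x $ 2) ^ j)"
    using assms unfolding circle_poly_def by blast
  have "trig_poly d (\<lambda>z. of_real (Re z) ^ i * of_real (Im z) ^ j)" if "i + j \<le> d" for i j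
    using trig_poly_mult[OF trig_poly_power[OF trig_poly_Re] trig_poly_power[OF trig_poly_Im]] that
    by (rule trig_poly_mono)
  then have "trig_poly d (\<lambda>z. \<Sum>p\<in>{(i, j). i + j \<le> d}. c (fst p) (snd p) *
      (of_real (Re z) ^ fst p * of_real (Im z) ^ snd p))"
    by (intro trig_poly_sum trig_poly_cmult) auto
  then show ?thesis
    by (rule trig_poly_cong)
      (simp add: c complex_to_plane_def[symmetric] case_prod_beta mult.assoc, simp add: complex_to_plane_def)
qed

lemma Poly_circle_eq:
  "Poly_circle d = sup_norm_space (sphere 0 1) {\<lambda>x\<in>sphere 0 1. h x | h. circle_poly d h}"
proof -
  have "{\<lambda>x\<in>sphere 0 1. \<Sum>(i, j)\<in>{(i, j). i + j \<le> d}.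
        c i j * complex_of_real (x $ 1) ^ i * complex_of_real (x $ 2) ^ j
      | c :: nat \<Rightarrow> nat \<Rightarrow> complex. True}
    = {\<lambda>x\<in>sphere 0 1. h x | h. circle_poly d h}" (is "?A = ?B")
  proof (rule Set.equalityI; rule subsetI)
    fix f assume "f \<in> ?A"
    then show "f \<in> ?B" unfolding circle_poly_def by blast
  next
    fix f assume "f \<in> ?B"
    then obtain h c where f: "f = (\<lambda>x\<in>sphere 0 1. h x)"
      and "\<forall>x. norm x = 1 \<longrightarrow> h x = (\<Sum>(i, j)\<in>{(i, j). i + j \<le> d}.
        c i j * complex_of_real (x $ 1) ^ i * complex_of_real (x $ 2) ^ j)"
      unfolding circle_poly_def by blast
    then have "f = (\<lambda>x\<in>sphere 0 1. \<Sum>(i, j)\<in>{(i, j). i + j \<le> d}.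
        c i j * complex_of_real (x $ 1) ^ i * complex_of_real (x $ 2) ^ j)"
      by (auto intro!: restrict_ext)
    then show "f \<in> ?A" by blast
  qed
  then show ?thesis by (simp only: Poly_circle_def)
qed

lemma projection_constant_Poly_circle_eq_Trig:
  "projection_constant TYPE('b) (Poly_circle d) = projection_constant TYPE('b) (Trig d)"
proof -
  let ?T = "{\<lambda>z\<in>sphere 0 1. h z | h. trig_poly d h}"
  let ?P = "{\<lambda>x\<in>sphere 0 1. h x | h. circle_poly d h}"
  define A where "A f = (\<lambda>x\<in>sphere 0 1. f (plane_to_complex x))" for f :: "complex \<Rightarrow> complex"
  define B where "B f = (\<lambda>z\<in>sphere 0 1. f (complex_to_plane z))" for f :: "real ^ 2 \<Rightarrow> complex"
  have A: "A f \<in> ?P" if "f \<in> ?T" for f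
  proof -
    obtain h where h: "f = (\<lambda>z\<in>sphere 0 1. h z)" "trig_poly d h" using \<open>f \<in> ?T\<close> by blast
    have "A f = (\<lambda>x\<in>sphere 0 1. h (plane_to_complex x))"
      unfolding A_def h(1) by (intro restrict_ext) simp
    then show ?thesis using circle_poly_if_trig_poly[OF h(2)] by blast
  qed
  have B: "B f \<in> ?T" if "f \<in> ?P" for f
  proof -
    obtain h where h: "f = (\<lambda>x\<in>sphere 0 1. h x)" "circle_poly d h" using \<open>f \<in> ?P\<close> by blast
    have "B f = (\<lambda>z\<in>sphere 0 1. h (complex_to_plane z))"
      unfolding B_def h(1) by (intro restrict_ext) simp
    then show ?thesis using trig_poly_if_circle_poly[OF h(2)] by blast
  qed
  have AB: "A (B f) = f" if "f \<in> ?P" for f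
    using that by (auto simp: A_def B_def intro!: restrict_ext)
  have BA: "B (A f) = f" if "f \<in> ?T" for f
    using that by (auto simp: A_def B_def intro!: restrict_ext)
  have im: "plane_to_complex ` sphere 0 1 = sphere 0 1" "complex_to_plane ` sphere 0 1 = sphere 0 1"
    by (auto intro!: image_eqI[of z _ "complex_to_plane z" for z] image_eqI[of z _ "plane_to_complex z" for z])
  have "isometric_embedding (Trig d) (Poly_circle d) A"
    unfolding Trig_eq Poly_circle_eq A_def[abs_def]
    by (rule isometric_embedding_reparametrize[OF im(1)]) (use A in \<open>simp only: A_def\<close>)
  moreover have "A ` carrier (Trig d) = carrier (Poly_circle d)"
    unfolding Trig_eq Poly_circle_eq sup_norm_space_simps using A B AB by (metis (no_types, lifting) image_eqI subsetI subset_antisym image_subsetI)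
  moreover have "isometric_embedding (Poly_circle d) (Trig d) B"
    unfolding Trig_eq Poly_circle_eq B_def[abs_def]
    by (rule isometric_embedding_reparametrize[OF im(2)]) (use B in \<open>simp only: B_def\<close>)
  moreover have "B ` carrier (Poly_circle d) = carrier (Trig d)"
    unfolding Trig_eq Poly_circle_eq sup_norm_space_simps using A B BA by (metis (no_types, lifting) image_eqI subsetI subset_antisym image_subsetI)
  ultimately show ?thesis by (metis antisym projection_constant_cong_isometry)
qed

section \<open>The upper bound\<close>

text \<open>A single M already yields a projection. Its norm is controlled by the absolute row sums
  of the interpolation matrix, because the extended evaluations have norm at most 1;
  \<open>B\<close> bounds these row sums.\<close>

lemma relative_projection_constant_Trig_le_Riemann_sum:
  assumes "complex_normed_space Y" and emb: "isometric_embedding (Trig d) Y I" and M: "2 * d < M"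
    and le: "\<And>z. cmod z = 1 \<Longrightarrow> (\<Sum>j<M. cmod (dirichlet d (z * cnj (unity_root M j)))) / real M \<le> B"
  shows "relative_projection_constant (I ` carrier (Trig d)) Y \<le> ereal B"
proof -
  interpret Y: complex_normed_space Y by fact
  interpret T: function_space "sphere 0 1" "{\<lambda>z\<in>sphere 0 1. h z | h. trig_poly d h}"
    by (rule function_space_Trig)
  have nT: "complex_normed_space (Trig d)" unfolding Trig_eq by (rule T.complex_normed_space)
  have add: "f \<oplus>\<^bsub>Trig d\<^esub> g = (\<lambda>z\<in>sphere 0 1. f z + g z)"
    and smult: "a \<odot>\<^bsub>Trig d\<^esub> f = (\<lambda>z\<in>sphere 0 1. a * f z)" for f g a
    by (simp_all add: Trig_eq)
  \<comment> \<open>The four properties of an extension are bundled, so that one choice supplies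
    functionals for all j at once.\<close>
  define extends where "extends j \<phi> \<longleftrightarrow>
      (\<forall>y\<in>carrier Y. \<forall>z\<in>carrier Y. \<phi> (y \<oplus>\<^bsub>Y\<^esub> z) = \<phi> y + \<phi> z) \<and>
      (\<forall>a. \<forall>y\<in>carrier Y. \<phi> (a \<odot>\<^bsub>Y\<^esub> y) = a * \<phi> y) \<and>
      (\<forall>y\<in>carrier Y. cmod (\<phi> y) \<le> vnorm Y y) \<and>
      (\<forall>f\<in>carrier (Trig d). \<phi> (I f) = f (unity_root M j))" for j \<phi>
  have "\<exists>\<phi>. extends j \<phi>" for j
    unfolding extends_def
  proof (rule hahn_banach[OF nT \<open>complex_normed_space Y\<close> emb, of "\<lambda>f. f (unity_root M j)"])
    show "cmod (f (unity_root M j)) \<le> vnorm (Trig d) f" if "f \<in> carrier (Trig d)" for f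
      using that unfolding Trig_eq sup_norm_space_simps by (rule T.norm_le_vnorm) simp
    show "(f \<oplus>\<^bsub>Trig d\<^esub> g) (unity_root M j) = f (unity_root M j) + g (unity_root M j)" for f g
      by (simp add: add)
    show "(a \<odot>\<^bsub>Trig d\<^esub> f) (unity_root M j) = a * f (unity_root M j)" for a f
      by (simp add: smult)
  qed blast
  then obtain \<phi> where ext: "\<And>j. extends j (\<phi> j)" by metis
  have phi: "y \<in> carrier Y \<Longrightarrow> z \<in> carrier Y \<Longrightarrow> \<phi> j (y \<oplus>\<^bsub>Y\<^esub> z) = \<phi> j y + \<phi> j z"
    "y \<in> carrier Y \<Longrightarrow> \<phi> j (a \<odot>\<^bsub>Y\<^esub> y) = a * \<phi> j y"
    "y \<in> carrier Y \<Longrightarrow> cmod (\<phi> j y) \<le> vnorm Y y"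
    "f \<in> carrier (Trig d) \<Longrightarrow> \<phi> j (I f) = f (unity_root M j)" for j a y z f
    using ext[of j] unfolding extends_def by blast+
  \<comment> \<open>This is the interpolation formula with the sample at the j-th root replaced by
    the extended evaluation; composed with \<open>I\<close> it becomes the projection.\<close>
  define Q where "Q y = (\<lambda>z\<in>sphere 0 1. \<Sum>j<M. \<phi> j y * (dirichlet d (z * cnj (unity_root M j)) / of_nat M))" for y
  have Q_in: "Q y \<in> carrier (Trig d)" for y
    unfolding Q_def carrier_Trig
    by (intro CollectI exI conjI) (rule refl, rule trig_poly_kernel_sum)
  have Q_add: "Q (y \<oplus>\<^bsub>Y\<^esub> z) = Q y \<oplus>\<^bsub>Trig d\<^esub> Q z" if "y \<in> carrier Y" "z \<in> carrier Y" for y z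
    unfolding add using that by (simp add: Q_def phi distrib_right add_divide_distrib sum.distrib cong: restrict_cong)
  have Q_smult: "Q (a \<odot>\<^bsub>Y\<^esub> y) = a \<odot>\<^bsub>Trig d\<^esub> Q y" if "y \<in> carrier Y" for y a
    unfolding smult using that by (simp add: Q_def phi sum_distrib_left mult.assoc cong: restrict_cong)
  have Q_I: "Q (I f) = f" if f: "f \<in> carrier (Trig d)" for f
  proof -
    obtain h where h: "f = (\<lambda>z\<in>sphere 0 1. h z)" "trig_poly d h" using f by (auto simp: carrier_Trig)
    have "Q (I f) = (\<lambda>z\<in>sphere 0 1. h z)"
      unfolding Q_def
    proof (rule restrict_ext)
      fix z :: complex assume "z \<in> sphere 0 1"
      then have "h z = (\<Sum>j<M. h (unity_root M j) * (dirichlet d (z * cnj (unity_root M j)) / of_nat M))"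
        using discrete_reproduction[OF h(2) M] by simp
      then show "(\<Sum>j<M. \<phi> j (I f) * (dirichlet d (z * cnj (unity_root M j)) / of_nat M)) = h z"
        using phi(4)[OF f] h(1) by simp
    qed
    then show ?thesis using h(1) by simp
  qed
  \<comment> \<open>The sign is read off from the hypothesis at the point 1; it allows passing from
    vectors of norm at most 1 to the bound \<open>B\<close>.\<close>
  have "B \<ge> 0" using le[of 1] by (rule order_trans[rotated]) (auto intro!: divide_nonneg_nonneg sum_nonneg)
  have Q_norm: "vnorm (Trig d) (Q y) \<le> B * vnorm Y y" if y: "y \<in> carrier Y" for y
    unfolding Trig_eq
  proof (rule T.vnorm_le)
    fix z :: complex assume z: "z \<in> sphere 0 1"
    have "cmod (Q y z) \<le> (\<Sum>j<M. cmod (\<phi> j y * (dirichlet d (z * cnj (unity_root M j)) / of_nat M)))"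
      unfolding Q_def restrict_apply'[OF z] by (rule norm_sum)
    also have "\<dots> \<le> (\<Sum>j<M. vnorm Y y * (cmod (dirichlet d (z * cnj (unity_root M j))) / real M))"
      using phi(3)[OF y] by (intro sum_mono) (simp add: norm_mult norm_divide mult_right_mono divide_right_mono)
    also have "\<dots> = vnorm Y y * ((\<Sum>j<M. cmod (dirichlet d (z * cnj (unity_root M j)))) / real M)"
      by (simp only: sum_distrib_left[symmetric] sum_divide_distrib)
    also have "\<dots> \<le> vnorm Y y * B"
      using le[of z] z Y.vnorm_nonneg[OF y] by (intro mult_left_mono) auto
    finally show "cmod (Q y z) \<le> B * vnorm Y y" by (simp add: mult.commute)
  qed
  have I: "I f \<in> I ` carrier (Trig d)" "vnorm Y (I f) = vnorm (Trig d) f"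
    "I (f \<oplus>\<^bsub>Trig d\<^esub> g) = I f \<oplus>\<^bsub>Y\<^esub> I g" "I (a \<odot>\<^bsub>Trig d\<^esub> f) = a \<odot>\<^bsub>Y\<^esub> I f"
    if "f \<in> carrier (Trig d)" "g \<in> carrier (Trig d)" for f g a
    using emb that unfolding isometric_embedding_def linear_op_def by blast+
  let ?V = "Y\<lparr>carrier := I ` carrier (Trig d)\<rparr>"
  have norm_le: "vnorm ?V (I (Q y)) \<le> B * vnorm Y y" if "y \<in> carrier Y" for y
    using Q_norm[OF that] I(2)[OF Q_in Q_in] by simp
  have "bounded_op Y ?V (\<lambda>y. I (Q y))"
    unfolding bounded_op_def linear_op_def using norm_le
    by (auto simp: Q_add Q_smult I(1,3,4)[OF Q_in Q_in])
  moreover have "\<forall>v\<in>I ` carrier (Trig d). I (Q v) = v" using Q_I by auto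
  ultimately have "relative_projection_constant (I ` carrier (Trig d)) Y \<le> ereal (op_norm Y ?V (\<lambda>y. I (Q y)))"
    unfolding relative_projection_constant_def by (intro INF_lower) auto
  also have "op_norm Y ?V (\<lambda>y. I (Q y)) \<le> B"
    unfolding op_norm_def
  proof (rule cSUP_least)
    show "{x \<in> carrier Y. vnorm Y x \<le> 1} \<noteq> {}"
      using Y.vnorm_zero by (auto intro!: exI[of _ "\<zero>\<^bsub>Y\<^esub>"])
    fix y assume "y \<in> {x \<in> carrier Y. vnorm Y x \<le> 1}"
    then show "vnorm ?V (I (Q y)) \<le> B"
      using norm_le[of y] mult_left_mono[of "vnorm Y y" 1 B] \<open>B \<ge> 0\<close> by auto
  qed
  finally show ?thesis by simp
qed

text \<open>Each M has its own projection; what converges is the sequence of their bounds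
  \<open>lebesgue_const d + K / real M\<close>.\<close>

lemma relative_projection_constant_Trig_le:
  assumes "complex_normed_space Y" "isometric_embedding (Trig d) Y I"
  shows "relative_projection_constant (I ` carrier (Trig d)) Y \<le> ereal (lebesgue_const d)"
proof -
  obtain K where K: "\<And>M z. M > 0 \<Longrightarrow> cmod z = 1 \<Longrightarrow>
    \<bar>(\<Sum>j<M. cmod (dirichlet d (z * cnj (unity_root M j)))) / real M - lebesgue_const d\<bar> \<le> K / real M"
    using lebesgue_const_Riemann_sum by blast
  have lim: "(\<lambda>M. ereal (lebesgue_const d + K / real M)) \<longlonglongrightarrow> ereal (lebesgue_const d + 0)"
    by (intro tendsto_intros lim_const_over_n)
  have ge: "relative_projection_constant (I ` carrier (Trig d)) Y \<le> ereal (lebesgue_const d + K / real M)"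
    if "M \<ge> Suc (2 * d)" for M
  proof (rule relative_projection_constant_Trig_le_Riemann_sum[OF assms])
    show "2 * d < M" using that by simp
    show "(\<Sum>j<M. cmod (dirichlet d (z * cnj (unity_root M j)))) / real M \<le> lebesgue_const d + K / real M"
      if "cmod z = 1" for z
      using K[of M z] that \<open>2 * d < M\<close> by (simp add: abs_le_iff)
  qed
  have "relative_projection_constant (I ` carrier (Trig d)) Y \<le> ereal (lebesgue_const d + 0)"
    by (rule LIMSEQ_le_const[OF lim]) (use ge in blast)
  then show ?thesis by simp
qed

section \<open>The lower bound\<close>

text \<open>
  Averaging a projection over the rotations by the \<open>M\<close>-th roots of unity leaves the partial Fourier
  sum, whose value at 1 is the discrete convolution with the Dirichlet kernel.
\<close>

lemma relative_projection_constant_Trig_ge_partial_sum: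
  assumes "complex_normed_space Y" and emb: "isometric_embedding (Trig N) Y J"
    and N: "d \<le> N" "N + d < M"
    and f: "trig_poly N f" "\<And>z. cmod z = 1 \<Longrightarrow> cmod (f z) \<le> 1"
  shows "ereal (cmod (\<Sum>j<M. f (unity_root M j) * dirichlet d (cnj (unity_root M j))) / real M)
    \<le> relative_projection_constant (J ` carrier (Trig d)) Y"
  unfolding relative_projection_constant_def
proof (rule INF_greatest)
  interpret Y: complex_normed_space Y by fact
  interpret TN: function_space "sphere 0 1" "{\<lambda>z\<in>sphere 0 1. h z | h. trig_poly N h}"
    by (rule function_space_Trig)
  interpret Td: function_space "sphere 0 1" "{\<lambda>z\<in>sphere 0 1. h z | h. trig_poly d h}"
    by (rule function_space_Trig)
  let ?V = "Y\<lparr>carrier := J ` carrier (Trig d)\<rparr>"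
  fix P assume "P \<in> {P. bounded_op Y ?V P \<and> (\<forall>x\<in>J ` carrier (Trig d). P x = x)}"
  then have P: "bounded_op Y ?V P" and P_id: "\<And>x. x \<in> J ` carrier (Trig d) \<Longrightarrow> P x = x" by auto
  have P_in: "P y \<in> J ` carrier (Trig d)" if "y \<in> carrier Y" for y
    using P that by (auto simp: bounded_op_def linear_op_def)
  have P_add: "P (x \<oplus>\<^bsub>Y\<^esub> y) = P x \<oplus>\<^bsub>Y\<^esub> P y" if "x \<in> carrier Y" "y \<in> carrier Y" for x y
    using P that by (auto simp: bounded_op_def linear_op_def)
  have P_smult: "P (a \<odot>\<^bsub>Y\<^esub> x) = a \<odot>\<^bsub>Y\<^esub> P x" if "x \<in> carrier Y" for a x
    using P that by (auto simp: bounded_op_def linear_op_def)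
  have P_norm: "vnorm Y (P y) \<le> op_norm Y ?V P" if y: "y \<in> carrier Y" "vnorm Y y \<le> 1" for y
  proof -
    obtain C where C: "\<And>x. x \<in> carrier Y \<Longrightarrow> vnorm Y (P x) \<le> C * vnorm Y x"
      using P by (auto simp: bounded_op_def)
    \<comment> \<open>\<open>op_norm\<close> is a supremum of reals and bounds the values only once
      they are known to be bounded above.\<close>
    have "bdd_above ((\<lambda>x. vnorm ?V (P x)) ` {x \<in> carrier Y. vnorm Y x \<le> 1})"
    proof (rule bdd_aboveI2)
      fix x assume x: "x \<in> {x \<in> carrier Y. vnorm Y x \<le> 1}"
      have "C * vnorm Y x \<le> \<bar>C\<bar> * 1"
        using x Y.vnorm_nonneg[of x] by (intro mult_mono) auto
      then show "vnorm ?V (P x) \<le> \<bar>C\<bar>" using C[of x] x by simp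
    qed
    then have "vnorm ?V (P y) \<le> op_norm Y ?V P"
      unfolding op_norm_def using y by (intro cSUP_upper) auto
    then show ?thesis by simp
  qed
  have sub: "f \<in> carrier (Trig N)" if "f \<in> carrier (Trig d)" for f
    using that N(1) trig_poly_mono unfolding carrier_Trig by blast
  have ops: "f \<oplus>\<^bsub>Trig n\<^esub> g = (\<lambda>z\<in>sphere 0 1. f z + g z)"
    "a \<odot>\<^bsub>Trig n\<^esub> f = (\<lambda>z\<in>sphere 0 1. a * f z)" "vnorm (Trig n) f = (SUP z\<in>sphere 0 1. cmod (f z))" for f g a n
    by (simp_all add: Trig_eq vnorm_sup_norm_space)
  have cl: "f \<oplus>\<^bsub>Trig n\<^esub> g \<in> carrier (Trig n)" "a \<odot>\<^bsub>Trig n\<^esub> f \<in> carrier (Trig n)"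
    if "f \<in> carrier (Trig n)" "g \<in> carrier (Trig n)" for f g a n
    using that function_space.add_in[OF function_space_Trig] function_space.smult_in[OF function_space_Trig]
    unfolding Trig_eq sup_norm_space_simps by blast+
  have J_in: "J f \<in> carrier Y" and J_norm: "vnorm Y (J f) = vnorm (Trig N) f"
    if "f \<in> carrier (Trig N)" for f
    using emb that by (auto simp: isometric_embedding_def linear_op_def)
  have J_add: "J (f \<oplus>\<^bsub>Trig N\<^esub> g) = J f \<oplus>\<^bsub>Y\<^esub> J g" if "f \<in> carrier (Trig N)" "g \<in> carrier (Trig N)" for f g
    using emb that by (auto simp: isometric_embedding_def linear_op_def)
  have J_smult: "J (a \<odot>\<^bsub>Trig N\<^esub> f) = a \<odot>\<^bsub>Y\<^esub> J f" if "f \<in> carrier (Trig N)" for f a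
    using emb that by (auto simp: isometric_embedding_def linear_op_def)
  \<comment> \<open>The projection is pulled back along \<open>J\<close> to the polynomials of
    degree at most N. An isometry is injective, so the chosen preimage is unique and
    \<open>T\<close> inherits linearity from \<open>P\<close>.\<close>
  define T where "T g = (SOME h. h \<in> carrier (Trig d) \<and> J h = P (J g))" for g
  have T: "T g \<in> carrier (Trig d)" "J (T g) = P (J g)" if "g \<in> carrier (Trig N)" for g
  proof -
    have "\<exists>h. h \<in> carrier (Trig d) \<and> J h = P (J g)" using P_in[OF J_in[OF that]] by auto
    then have "T g \<in> carrier (Trig d) \<and> J (T g) = P (J g)" unfolding T_def by (rule someI_ex)
    then show "T g \<in> carrier (Trig d)" "J (T g) = P (J g)" by auto
  qed
  have J_inj: "f = g" if fg: "f \<in> carrier (Trig N)" "g \<in> carrier (Trig N)" "J f = J g" for f g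
  proof -
    let ?k = "f \<oplus>\<^bsub>Trig N\<^esub> (- 1) \<odot>\<^bsub>Trig N\<^esub> g"
    have k: "?k \<in> carrier (Trig N)" using fg cl by blast
    have "J ?k = \<zero>\<^bsub>Y\<^esub>" using fg cl by (simp add: J_add J_smult J_in Y.add_neg)
    then have "vnorm (Trig N) ?k = 0" using J_norm[OF k] by (simp add: Y.vnorm_zero)
    then have "cmod (?k z) \<le> 0" if "z \<in> sphere 0 1" for z
      using TN.norm_le_vnorm[of ?k z] k that unfolding Trig_eq sup_norm_space_simps by simp
    then have "f z = g z" if "z \<in> sphere 0 1" for z using that by (simp add: ops)
    then show ?thesis using fg unfolding Trig_eq sup_norm_space_simps by (intro TN.ext_eqI)
  qed
  have T_id: "T g = g" if "g \<in> carrier (Trig d)" for g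
    using J_inj T sub that P_id by (metis image_eqI)
  have T_lin: "linear_op (Trig N) (Trig d) T"
    unfolding linear_op_def
  proof (intro conjI ballI allI)
    show "T \<in> carrier (Trig N) \<rightarrow> carrier (Trig d)" using T by auto
  next
    fix g h assume gh: "g \<in> carrier (Trig N)" "h \<in> carrier (Trig N)"
    have eq: "T g \<oplus>\<^bsub>Trig d\<^esub> T h = T g \<oplus>\<^bsub>Trig N\<^esub> T h" by (simp add: ops)
    show "T (g \<oplus>\<^bsub>Trig N\<^esub> h) = T g \<oplus>\<^bsub>Trig d\<^esub> T h"
      unfolding eq using gh T sub cl J_in
      by (intro J_inj) (simp_all add: J_add P_add)
  next
    fix a g assume g: "g \<in> carrier (Trig N)"
    have eq: "a \<odot>\<^bsub>Trig d\<^esub> T g = a \<odot>\<^bsub>Trig N\<^esub> T g" by (simp add: ops)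
    show "T (a \<odot>\<^bsub>Trig N\<^esub> g) = a \<odot>\<^bsub>Trig d\<^esub> T g"
      unfolding eq using g T sub cl J_in
      by (intro J_inj) (simp_all add: J_smult P_smult)
  qed
  have T_norm: "cmod (T g z) \<le> op_norm Y ?V P"
    if g: "g \<in> carrier (Trig N)" "\<And>z. cmod z = 1 \<Longrightarrow> cmod (g z) \<le> 1" and z: "cmod z = 1" for g z
  proof -
    have "vnorm (Trig N) g \<le> 1" unfolding Trig_eq using g(2) by (intro TN.vnorm_le) auto
    then have "vnorm Y (P (J g)) \<le> op_norm Y ?V P" using g by (intro P_norm) (simp_all add: J_in J_norm)
    then have "vnorm (Trig d) (T g) \<le> op_norm Y ?V P"
      using T[OF g(1)] J_norm[OF sub[OF T(1)[OF g(1)]]] by (simp add: ops(3))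
    moreover have "cmod (T g z) \<le> vnorm (Trig d) (T g)"
      using T(1)[OF g(1)] z unfolding Trig_eq sup_norm_space_simps by (intro Td.norm_le_vnorm) auto
    ultimately show ?thesis by simp
  qed
  define E where "E k = (\<lambda>z\<in>sphere (0 :: complex) 1. z powi k)" for k :: int
  have E_in: "E k \<in> carrier (Trig n)" if "\<bar>k\<bar> \<le> int n" for k n
    unfolding E_def carrier_Trig using trig_poly_powi[OF that] by blast
  \<comment> \<open>For |k| <= d the exponential is fixed by \<open>T\<close>, so its coefficients
    can be taken as the indicator of k, which makes the diagonal entry 1.\<close>
  have "\<exists>a. (\<forall>z. cmod z = 1 \<longrightarrow> T (E k) z = (\<Sum>l = - int d..int d. a l * z powi l)) \<and>
      (\<bar>k\<bar> \<le> int d \<longrightarrow> a k = 1)" (is "\<exists>a. ?coeffs k a") if k: "\<bar>k\<bar> \<le> int N" for k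
  proof (cases "\<bar>k\<bar> \<le> int d")
    case True
    then have "T (E k) z = (\<Sum>l = - int d..int d. (if l = k then 1 else 0) * z powi l)" if "cmod z = 1" for z
      using that T_id[OF E_in[OF True]]
      by (simp add: E_def if_distrib[of "\<lambda>x. x * _"] abs_le_iff minus_le_iff cong: if_cong)
    then show ?thesis by (intro exI[of _ "\<lambda>l. if l = k then 1 else 0"]) simp
  next
    case False
    then show ?thesis using T(1)[OF E_in[OF k]] unfolding carrier_Trig trig_poly_def by auto
  qed
  then have "\<forall>k. \<exists>a. \<bar>k\<bar> \<le> int N \<longrightarrow> ?coeffs k a" by blast
  from choice[OF this] obtain a where "\<And>k. \<bar>k\<bar> \<le> int N \<Longrightarrow> ?coeffs k (a k)" by blast
  then have a: "\<bar>k\<bar> \<le> int N \<Longrightarrow> cmod z = 1 \<Longrightarrow> T (E k) z = (\<Sum>l = - int d..int d. a k l * z powi l)"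
    and a_diag: "\<bar>k\<bar> \<le> int d \<Longrightarrow> a k k = 1" for k z
    using N(1) by auto
  obtain c where c: "\<And>z. cmod z = 1 \<Longrightarrow> f z = (\<Sum>k = - int N..int N. c k * z powi k)"
    using f(1) unfolding trig_poly_def by blast
  \<comment> \<open>\<open>g s\<close> is \<open>f\<close> rotated by the s-th root. Evaluating its
    image under \<open>T\<close> at the conjugate root undoes the rotation and observes the
    conjugated projection at the point 1.\<close>
  define g where "g s = (\<lambda>z\<in>sphere 0 1. \<Sum>k = - int N..int N. (c k * unity_root M s powi k) * E k z)" for s
  have g_eq: "g s z = f (z * unity_root M s)" if "cmod z = 1" for s z
    using that c[of "z * unity_root M s"]
    by (simp add: g_def E_def norm_mult power_int_mult_distrib mult_ac)
  have g_in: "g s \<in> carrier (Trig N)" for s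
    using E_in[of _ N] unfolding g_def Trig_eq sup_norm_space_simps by (intro TN.sum_in) auto
  have "T (g s) (cnj (unity_root M s)) =
      (\<Sum>k = - int N..int N. \<Sum>l = - int d..int d. c k * a k l * unity_root M s powi (k - l))" for s
  proof -
    have "T (g s) (cnj (unity_root M s))
        = (\<Sum>k = - int N..int N. (c k * unity_root M s powi k) * T (E k) (cnj (unity_root M s)))"
      unfolding g_def
      by (rule TN.linear_op_sum[OF T_lin[unfolded Trig_eq]])
        (use E_in[of _ N] in \<open>auto simp: Trig_eq\<close>)
    also have "\<dots> = (\<Sum>k = - int N..int N. \<Sum>l = - int d..int d. c k * a k l * unity_root M s powi (k - l))"
    proof (intro sum.cong refl)
      fix k assume "k \<in> {- int N..int N}"
      then have "T (E k) (cnj (unity_root M s)) = (\<Sum>l = - int d..int d. a k l * cnj (unity_root M s) powi l)"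
        by (intro a) auto
      then show "c k * unity_root M s powi k * T (E k) (cnj (unity_root M s))
          = (\<Sum>l = - int d..int d. c k * a k l * unity_root M s powi (k - l))"
        by (simp add: sum_distrib_left power_int_diff cnj_eq_inverse power_int_inverse divide_inverse mult_ac)
    qed
    finally show ?thesis .
  qed
  then have "(\<Sum>s<M. T (g s) (cnj (unity_root M s)))
      = (\<Sum>s<M. \<Sum>k = - int N..int N. \<Sum>l = - int d..int d. c k * a k l * unity_root M s powi (k - l))"
    by simp
  also have "\<dots> = (\<Sum>l = - int d..int d. \<Sum>k = - int N..int N. \<Sum>s<M. c k * a k l * unity_root M s powi (k - l))"
    by (subst sum.swap, subst sum.swap[of _ "{..<M}"], subst sum.swap) (rule refl)
  \<comment> \<open>Orthogonality keeps k = l only, and there the entry of the projection is 1: the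
    average no longer depends on \<open>P\<close>.\<close>
  also have "\<dots> = (\<Sum>l = - int d..int d. \<Sum>k = - int N..int N. if k = l then of_nat M * c l else 0)"
  proof (intro sum.cong refl)
    fix l k assume l: "l \<in> {- int d..int d}" and k: "k \<in> {- int N..int N}"
    have "int M dvd k - l \<longleftrightarrow> k = l"
      using l k N zdvd_imp_le[of "int M" "\<bar>k - l\<bar>"] by (cases "k = l") auto
    then show "(\<Sum>s<M. c k * a k l * unity_root M s powi (k - l)) = (if k = l then of_nat M * c l else 0)"
      using N l a_diag[of l] by (simp add: sum_unity_root_powi abs_le_iff minus_le_iff flip: sum_distrib_left)
  qed
  also have "\<dots> = (\<Sum>l = - int d..int d. of_nat M * c l)"
    using N by (intro sum.cong refl) (auto simp: sum.delta)
  \<comment> \<open>The remaining sum is M times the partial Fourier sum at 1, rewritten as a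
    convolution so that the kernel appears.\<close>
  also have "\<dots> = (\<Sum>j<M. f (unity_root M j) * dirichlet d (cnj (unity_root M j)))"
    using discrete_partial_sum[OF N, of 1 f c] c by (simp add: sum_distrib_left)
  finally have "cmod (\<Sum>j<M. f (unity_root M j) * dirichlet d (cnj (unity_root M j)))
      = cmod (\<Sum>s<M. T (g s) (cnj (unity_root M s)))" by simp
  also have "\<dots> \<le> (\<Sum>s<M. op_norm Y ?V P)"
    using g_in g_eq f(2) by (intro sum_norm_le T_norm) (auto simp: norm_mult)
  finally show "ereal (cmod (\<Sum>j<M. f (unity_root M j) * dirichlet d (cnj (unity_root M j))) / real M)
      \<le> ereal (op_norm Y ?V P)"
    using N(2) by (simp add: field_simps)
qed

section \<open>Approximating the sign of the kernel\<close>

text \<open>This makes the Stone--Weierstrass approximants trigonometric polynomials. A real-linear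
  functional on the plane is a combination of Re and Im, and degrees take the maximum under sums and
  add under products.\<close>

lemma trig_poly_if_real_polynomial_function:
  fixes p :: "complex \<Rightarrow> real"
  assumes "real_polynomial_function p"
  shows "\<exists>N. trig_poly N (\<lambda>z. of_real (p z))"
  using assms
proof induction
  case (linear p)
  interpret bounded_linear p by fact
  have p: "p z = Re z * p 1 + Im z * p \<i>" for z
  proof -
    have "z = Re z *\<^sub>R 1 + Im z *\<^sub>R \<i>" by (simp add: complex_eq_iff)
    then have "p z = p (Re z *\<^sub>R 1 + Im z *\<^sub>R \<i>)" by simp
    then show ?thesis by (simp only: add scaleR real_scaleR_def)
  qed
  have "trig_poly 1 (\<lambda>z. of_real (p 1) * of_real (Re z) + of_real (p \<i>) * of_real (Im z))"
    by (intro trig_poly_add trig_poly_cmult trig_poly_Re trig_poly_Im)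
  then have "trig_poly 1 (\<lambda>z. of_real (p z))"
  proof (rule trig_poly_cong)
    show "complex_of_real (p 1) * of_real (Re z) + of_real (p \<i>) * of_real (Im z) = of_real (p z)" for z
      unfolding p[of z] by (simp add: mult.commute)
  qed
  then show ?case ..
next
  case (const c)
  show ?case using trig_poly_const by blast
next
  case (add f g)
  then obtain m n where "trig_poly m (\<lambda>z. of_real (f z))" "trig_poly n (\<lambda>z. of_real (g z))" by blast
  then have "trig_poly (max m n) (\<lambda>z. of_real (f z) + of_real (g z))"
    by (intro trig_poly_add) (auto intro: trig_poly_mono)
  then show ?case by auto
next
  case (mult f g)
  then obtain m n where "trig_poly m (\<lambda>z. of_real (f z))" "trig_poly n (\<lambda>z. of_real (g z))" by blast
  then have "trig_poly (m + n) (\<lambda>z. of_real (f z) * of_real (g z))" by (rule trig_poly_mult)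
  then show ?case by auto
qed

lemma trig_poly_if_polynomial_function:
  fixes p :: "complex \<Rightarrow> complex"
  assumes "polynomial_function p"
  obtains N where "trig_poly N p"
proof -
  have "real_polynomial_function (Re \<circ> p)" and "real_polynomial_function (Im \<circ> p)"
    using assms bounded_linear_Re bounded_linear_Im unfolding polynomial_function_def by blast+
  from this[THEN trig_poly_if_real_polynomial_function]
  obtain m n where "trig_poly m (\<lambda>z. of_real (Re (p z)))" "trig_poly n (\<lambda>z. of_real (Im (p z)))"
    unfolding comp_def by blast
  then have "trig_poly (max m n) (\<lambda>z. of_real (Re (p z)) + \<i> * of_real (Im (p z)))"
    by (intro trig_poly_add trig_poly_cmult) (auto intro: trig_poly_mono)
  then have "trig_poly (max m n) p" by (rule trig_poly_cong) (simp add: complex_eq_iff)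
  then show thesis by (rule that)
qed

text \<open>The sign conj(D)/|D| breaks down at the zeros of the kernel D. With |D| + \<delta> in
  the denominator it becomes continuous, keeps modulus at most 1, and multiplies D to within
  \<delta> of |D|.\<close>

lemma trig_poly_almost_sign:
  assumes e: "e > 0"
  obtains N f where "d \<le> N" "trig_poly N f" "\<And>z. cmod z = 1 \<Longrightarrow> cmod (f z) \<le> 1"
    "\<And>z. cmod z = 1 \<Longrightarrow> cmod (f z * dirichlet d (cnj z) - of_real (cmod (dirichlet d (cnj z)))) \<le> e"
proof -
  define D where "D z = dirichlet d (cnj z)" for z
  \<comment> \<open>The three errors below amount to \<delta> + 2 \<delta> |D| with |D| <= 2 d + 1,
    hence at most \<delta> (4 d + 3).\<close>
  define \<delta> where "\<delta> = e / (4 * real d + 3)"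
  have \<delta>: "\<delta> > 0" using e by (simp add: \<delta>_def)
  define u where "u z = cnj (D z) / of_real (cmod (D z) + \<delta>)" for z
  have den: "cmod (D z) + \<delta> > 0" for z using \<delta> by (simp add: add_nonneg_pos)
  have "continuous_on (sphere 0 1) D"
    unfolding D_def dirichlet_def by (intro continuous_intros) auto
  moreover have "complex_of_real (cmod (D z) + \<delta>) \<noteq> 0" for z
    using den[of z] by (metis less_irrefl of_real_eq_0_iff)
  ultimately have "continuous_on (sphere 0 1) u"
    unfolding u_def by (intro continuous_intros) auto
  then obtain p where p: "polynomial_function p" "\<And>z. z \<in> sphere 0 1 \<Longrightarrow> cmod (u z - p z) < \<delta>"
    using Stone_Weierstrass_polynomial_function[of "sphere 0 1" u \<delta>] \<delta> by auto
  then obtain N where N: "trig_poly N p" using trig_poly_if_polynomial_function by blast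
  \<comment> \<open>An approximant within \<delta> of \<open>u\<close> may have modulus up to 1 +
    \<delta>; rescaling restores the bound 1 exactly.\<close>
  define f where "f z = of_real (1 / (1 + \<delta>)) * p z" for z
  show thesis
  proof
    show "d \<le> max N d" by simp
    show "trig_poly (max N d) f"
      unfolding f_def by (intro trig_poly_cmult trig_poly_mono[OF N]) simp
  next
    fix z :: complex assume z: "cmod z = 1"
    have cu: "cmod (u z) \<le> 1" using den[of z] \<delta> by (simp add: u_def norm_divide abs_of_pos del: of_real_add)
    have up: "cmod (u z - p z) \<le> \<delta>" using p(2)[of z] z by simp
    have "cmod (p z) \<le> 1 + \<delta>" using cu up norm_triangle_ineq4[of "u z" "u z - p z"] by simp
    then show "cmod (f z) \<le> 1" using \<delta> by (simp add: f_def norm_mult norm_divide flip: of_real_add)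
    have D_le: "cmod (D z) \<le> 2 * real d + 1"
    proof -
      obtain t where "cnj z = cis t" using cmod_1_eq_cis[of "cnj z"] z by auto
      then show ?thesis using abs_dirichlet_le[of d t] by (simp add: D_def abs_dirichlet_def)
    qed
    have "u z * D z = of_real ((cmod (D z))\<^sup>2 / (cmod (D z) + \<delta>))"
      using complex_norm_square[of "D z"] by (simp add: u_def mult.commute)
    also have "(cmod (D z))\<^sup>2 / (cmod (D z) + \<delta>) = cmod (D z) - \<delta> * (cmod (D z) / (cmod (D z) + \<delta>))"
      using den[of z] by (simp add: field_simps power2_eq_square)
    finally have "cmod (u z * D z - of_real (cmod (D z))) = cmod (of_real (- (\<delta> * (cmod (D z) / (cmod (D z) + \<delta>)))) :: complex)"
      by simp
    also have "\<dots> = \<delta> * (cmod (D z) / (cmod (D z) + \<delta>))"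
      using den[of z] \<delta> by (simp only: norm_of_real) simp
    also have "\<dots> \<le> \<delta> * 1" using den[of z] \<delta> by (intro mult_left_mono) (auto simp: field_simps)
    finally have 1: "cmod (u z * D z - of_real (cmod (D z))) \<le> \<delta>" by simp
    have 2: "cmod ((u z - p z) * D z) \<le> \<delta> * cmod (D z)"
      unfolding norm_mult using up by (intro mult_right_mono) auto
    have 3: "cmod (of_real (\<delta> * cmod (D z)) :: complex) = \<delta> * cmod (D z)"
      using \<delta> by (simp add: norm_mult)
    \<comment> \<open>The three terms separate the errors from regularising the sign, from the
      polynomial approximation and from the rescaling.\<close>
    have "of_real (1 + \<delta>) * (f z * D z - of_real (cmod (D z)))
        = (u z * D z - of_real (cmod (D z))) - (u z - p z) * D z - of_real (\<delta> * cmod (D z))"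
      using \<delta> unfolding f_def by (simp add: algebra_simps add_eq_0_iff flip: of_real_add of_real_mult)
    then have "(1 + \<delta>) * cmod (f z * D z - of_real (cmod (D z)))
        = cmod ((u z * D z - of_real (cmod (D z))) - (u z - p z) * D z - of_real (\<delta> * cmod (D z)))"
      using \<delta> by (metis norm_mult norm_of_real abs_of_pos add_pos_pos zero_less_one)
    also have "\<dots> \<le> \<delta> + \<delta> * cmod (D z) + \<delta> * cmod (D z)"
      using 1 2 3 norm_triangle_ineq4[of "u z * D z - of_real (cmod (D z)) - (u z - p z) * D z" "of_real (\<delta> * cmod (D z))"]
        norm_triangle_ineq4[of "u z * D z - of_real (cmod (D z))" "(u z - p z) * D z"]
      by linarith
    also have "\<dots> \<le> \<delta> + \<delta> * (2 * real d + 1) + \<delta> * (2 * real d + 1)"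
      using D_le \<delta> by (intro add_mono mult_left_mono) auto
    also have "\<dots> = \<delta> * (4 * real d + 3)" by (simp add: algebra_simps)
    also have "\<dots> = e" by (simp add: \<delta>_def)
    finally have "(1 + \<delta>) * cmod (f z * D z - of_real (cmod (D z))) \<le> e" .
    moreover have "1 * cmod (f z * D z - of_real (cmod (D z))) \<le> (1 + \<delta>) * cmod (f z * D z - of_real (cmod (D z)))"
      using \<delta> by (intro mult_right_mono) auto
    ultimately show "cmod (f z * dirichlet d (cnj z) - of_real (cmod (dirichlet d (cnj z)))) \<le> e"
      by (simp add: D_def)
  qed
qed

text \<open>The ambient space changes with the accuracy e, because the degree N of the almost-sign
  does; the supremum over all ambient spaces absorbs this.\<close>

lemma projection_constant_Trig_ge:
  assumes "\<exists>\<iota> :: real \<Rightarrow> 'b. inj \<iota>"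
  shows "ereal (lebesgue_const d) \<le> projection_constant TYPE('b) (Trig d)"
proof -
  obtain \<iota> :: "real \<Rightarrow> 'b" where \<iota>: "inj \<iota>" using assms by blast
  obtain K where K: "\<And>M z. M > 0 \<Longrightarrow> cmod z = 1 \<Longrightarrow>
    \<bar>(\<Sum>j<M. cmod (dirichlet d (z * cnj (unity_root M j)))) / real M - lebesgue_const d\<bar> \<le> K / real M"
    using lebesgue_const_Riemann_sum by blast
  have approx: "ereal (lebesgue_const d - e) \<le> projection_constant TYPE('b) (Trig d)" if e: "e > 0" for e
  proof -
    obtain N f where N: "d \<le> N" and f: "trig_poly N f" "\<And>z. cmod z = 1 \<Longrightarrow> cmod (f z) \<le> 1"
      and fD: "\<And>z. cmod z = 1 \<Longrightarrow> cmod (f z * dirichlet d (cnj z) - of_real (cmod (dirichlet d (cnj z)))) \<le> e"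
      using trig_poly_almost_sign[OF e, of d] by metis
    obtain h :: "(complex \<Rightarrow> complex) \<Rightarrow> real" where "inj_on h (carrier (Trig N))"
      using Trig_injects_reals by blast
    then have "inj_on (\<iota> \<circ> h) (carrier (Trig N))" using \<iota> by (auto intro: comp_inj_on inj_on_subset)
    then obtain Y :: "'b cnspace" where Y: "complex_banach_space Y" and emb: "isometric_embedding (Trig N) Y (\<iota> \<circ> h)"
      using complex_banach_space_transport[OF complex_banach_space_Trig] by blast
    have nY: "complex_normed_space Y" using Y by (simp add: complex_banach_space_def)
    have sub: "carrier (Trig d) \<subseteq> carrier (Trig N)"
      using N trig_poly_mono unfolding carrier_Trig by blast
    \<comment> \<open>The operations and the norm depend on the circle alone and not on the degree,
      so the embedding of the larger space restricts.\<close>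
    have "isometric_embedding (Trig d) Y (\<iota> \<circ> h)"
      using emb sub unfolding isometric_embedding_def linear_op_def
      by (auto simp: Trig_def sup_norm_space_def subset_iff Pi_iff)
    then have "(Y, \<iota> \<circ> h) \<in> {(Y, I). complex_banach_space Y \<and> isometric_embedding (Trig d) Y I}"
      using Y by simp
    from SUP_upper[OF this, of "\<lambda>(Y, I). relative_projection_constant (I ` carrier (Trig d)) Y"]
    have upper: "relative_projection_constant ((\<iota> \<circ> h) ` carrier (Trig d)) Y \<le> projection_constant TYPE('b) (Trig d)"
      by (simp add: projection_constant_def)
    \<comment> \<open>Now N is fixed and M grows: e measures the defect of the almost-sign, K/M that
      of the Riemann sum.\<close>
    have le: "ereal (lebesgue_const d - K / real M - e) \<le> projection_constant TYPE('b) (Trig d)"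
      if M: "M \<ge> Suc (N + d)" for M
    proof -
      let ?D = "\<lambda>j. dirichlet d (cnj (unity_root M j))"
      have "cmod ((\<Sum>j<M. f (unity_root M j) * ?D j) - of_real (\<Sum>j<M. cmod (?D j)))
          \<le> (\<Sum>j<M. cmod (f (unity_root M j) * ?D j - of_real (cmod (?D j))))"
        unfolding of_real_sum sum_subtractf[symmetric] by (rule norm_sum)
      also have "\<dots> \<le> (\<Sum>j<M. e)" by (intro sum_mono fD) simp
      finally have "cmod (of_real (\<Sum>j<M. cmod (?D j)) :: complex)
          \<le> cmod (\<Sum>j<M. f (unity_root M j) * ?D j) + real M * e"
        using norm_triangle_ineq2[of "of_real (\<Sum>j<M. cmod (?D j)) :: complex" "\<Sum>j<M. f (unity_root M j) * ?D j"]
        by (simp add: norm_minus_commute)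
      then have "(\<Sum>j<M. cmod (?D j)) \<le> cmod (\<Sum>j<M. f (unity_root M j) * ?D j) + real M * e"
        by (simp only: norm_of_real abs_of_nonneg[OF sum_nonneg[OF norm_ge_zero]])
      then have "(\<Sum>j<M. cmod (?D j)) / real M \<le> (cmod (\<Sum>j<M. f (unity_root M j) * ?D j) + real M * e) / real M"
        by (rule divide_right_mono) simp
      then have "(\<Sum>j<M. cmod (?D j)) / real M \<le> cmod (\<Sum>j<M. f (unity_root M j) * ?D j) / real M + e"
        using M by (simp add: add_divide_distrib)
      moreover have "lebesgue_const d - K / real M \<le> (\<Sum>j<M. cmod (?D j)) / real M"
        using K[of M 1] M by (simp add: abs_le_iff)
      ultimately have "lebesgue_const d - K / real M - e \<le> cmod (\<Sum>j<M. f (unity_root M j) * ?D j) / real M"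
        by linarith
      then have "ereal (lebesgue_const d - K / real M - e) \<le> ereal (cmod (\<Sum>j<M. f (unity_root M j) * ?D j) / real M)"
        by simp
      also have "\<dots> \<le> relative_projection_constant ((\<iota> \<circ> h) ` carrier (Trig d)) Y"
        using M by (intro relative_projection_constant_Trig_ge_partial_sum[OF nY emb N _ f]) auto
      also note upper
      finally show ?thesis .
    qed
    have lim: "(\<lambda>M. ereal (lebesgue_const d - K / real M - e)) \<longlonglongrightarrow> ereal (lebesgue_const d - 0 - e)"
      by (intro tendsto_intros lim_const_over_n)
    have "ereal (lebesgue_const d - 0 - e) \<le> projection_constant TYPE('b) (Trig d)"
      by (rule LIMSEQ_le_const2[OF lim]) (use le in blast)
    then show ?thesis by simp
  qed
  have lim: "(\<lambda>n. ereal (lebesgue_const d - inverse (real (Suc n)))) \<longlonglongrightarrow> ereal (lebesgue_const d - 0)"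
    by (intro tendsto_intros LIMSEQ_inverse_real_of_nat)
  have "ereal (lebesgue_const d - 0) \<le> projection_constant TYPE('b) (Trig d)"
    by (rule LIMSEQ_le_const2[OF lim]) (use approx in simp)
  then show ?thesis by simp
qed

lemma projection_constant_Trig:
  assumes "\<exists>\<iota> :: real \<Rightarrow> 'b. inj \<iota>"
  shows "projection_constant TYPE('b) (Trig d) = ereal (lebesgue_const d)"
proof (rule antisym)
  show "projection_constant TYPE('b) (Trig d) \<le> ereal (lebesgue_const d)"
    unfolding projection_constant_def
    by (rule SUP_least) (auto simp: complex_banach_space_def intro: relative_projection_constant_Trig_le)
qed (rule projection_constant_Trig_ge[OF assms])

theorem proposition4p9:
  assumes "\<exists>\<iota> :: real \<Rightarrow> 'b. inj \<iota>"
  shows "(\<forall>d::nat. d \<ge> 1 \<longrightarrow>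
            projection_constant TYPE('b) (Trig d) = projection_constant TYPE('b) (Poly_circle d) \<and>
            projection_constant TYPE('b) (Poly_circle d) =
              ereal (1 / (2 * pi) *
                integral {0..2 * pi} (\<lambda>t. \<bar>sin ((real d + 1 / 2) * t) / sin (t / 2)\<bar>))) \<and>
         (\<lambda>d. projection_constant TYPE('b) (Poly_circle d) / ereal (ln (real d)))
            \<longlonglongrightarrow> ereal (4 / pi\<^sup>2)"
proof
  have const: "projection_constant TYPE('b) (Poly_circle d) = ereal (lebesgue_const d)" for d
    by (simp add: projection_constant_Poly_circle_eq_Trig projection_constant_Trig[OF assms])
  then show "\<forall>d::nat. d \<ge> 1 \<longrightarrow>
            projection_constant TYPE('b) (Trig d) = projection_constant TYPE('b) (Poly_circle d) \<and>
            projection_constant TYPE('b) (Poly_circle d) =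
              ereal (1 / (2 * pi) *
                integral {0..2 * pi} (\<lambda>t. \<bar>sin ((real d + 1 / 2) * t) / sin (t / 2)\<bar>))"
    by (simp add: projection_constant_Poly_circle_eq_Trig lebesgue_const_def)
  have "(\<lambda>d. ereal (lebesgue_const d / ln (real d))) \<longlonglongrightarrow> ereal (4 / pi\<^sup>2)"
    by (rule tendsto_ereal[OF lebesgue_const_asymptotics])
  \<comment> \<open>At d = 1 the logarithm is 0, and division by 0 gives different values in
    \<open>real\<close> and \<open>ereal\<close>; the two quotients are therefore compared for d >
    1.\<close>
  moreover have "eventually (\<lambda>d. ereal (lebesgue_const d / ln (real d))
      = projection_constant TYPE('b) (Poly_circle d) / ereal (ln (real d))) sequentially"
    using eventually_gt_at_top[of 1] by eventually_elim (simp add: const)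
  ultimately show "(\<lambda>d. projection_constant TYPE('b) (Poly_circle d) / ereal (ln (real d)))
            \<longlonglongrightarrow> ereal (4 / pi\<^sup>2)"
    by (rule Lim_transform_eventually)
qed

end
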